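(* Let $N\ge2$ and $\rho>1$. There exists a Cantor set $X$ in $\mathbb{C}^N$ contained in the spherical shell $\{z\in\mathbb{C}^N: 1<\|z\|<\rho\}$ such that $h_r^{N-1}(X)$ contains the closed unit ball $\{z\in\mathbb{C}^N:\|z\|\le1\}$.
   Context: $\|z\|$ is the Euclidean norm on $\mathbb{C}^N$. An analytic subvariety of $\mathbb{C}^N$ of pure codimension $m$ means a pure-dimensional analytic subvariety of $\mathbb{C}^N$ of dimension $N-m$. For compact $X\subset\mathbb{C}^N$ and $1\le k\le N$, the $k$-rational hull $h_r^k(X)$ is the set of $z\in\mathbb{C}^N$ such that every analytic subvariety of $\mathbb{C}^N$ of pure codimension $\le k$ that passes through $z$ intersects $X$. *)

theory Defs
  imports "HOL-Analysis.Analysis"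
begin

definition cderiv_at :: "(complex ^ 'n \<Rightarrow> complex) \<Rightarrow> (complex ^ 'n \<Rightarrow> complex) \<Rightarrow> complex ^ 'n \<Rightarrow> bool" where
  "cderiv_at f f' z \<longleftrightarrow> (f has_derivative f') (at z) \<and> (\<forall>c v. f' (c *s v) = c * f' v)"

definition holo_CN :: "(complex ^ 'n \<Rightarrow> complex) \<Rightarrow> (complex ^ 'n) set \<Rightarrow> bool" where
  "holo_CN f U \<longleftrightarrow> open U \<and> (\<forall>z\<in>U. \<exists>f'. cderiv_at f f' z)"

definition analytic_subvariety :: "(complex ^ 'n) set \<Rightarrow> bool" where
  "analytic_subvariety V \<longleftrightarrow> closed V \<and>
     (\<forall>p\<in>V. \<exists>U fs. open U \<and> p \<in> U \<and> (\<forall>f\<in>set fs. holo_CN f U) \<and>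
        V \<inter> U = {z\<in>U. \<forall>f\<in>set fs. f z = 0})"

text \<open>p is a regular point of V of dimension d: near p, V is a complex submanifold of
  dimension d, i.e. the zero set of N-d holomorphic functions with C-linearly independent
  differentials at p.\<close>
definition regular_point_dim :: "(complex ^ 'n) set \<Rightarrow> complex ^ 'n \<Rightarrow> nat \<Rightarrow> bool" where
  "regular_point_dim V p d \<longleftrightarrow> p \<in> V \<and> d \<le> CARD('n) \<and>
     (\<exists>U fs fs'. open U \<and> p \<in> U \<and> length fs = CARD('n) - d \<and> length fs' = length fs \<and>
        (\<forall>f\<in>set fs. holo_CN f U) \<and>
        V \<inter> U = {z\<in>U. \<forall>f\<in>set fs. f z = 0} \<and>
        (\<forall>i<length fs. cderiv_at (fs ! i) (fs' ! i) p) \<and>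
        (\<forall>w::nat \<Rightarrow> complex. \<exists>v. \<forall>i<length fs. (fs' ! i) v = w i))"

definition pure_dim_subvariety :: "(complex ^ 'n) set \<Rightarrow> nat \<Rightarrow> bool" where
  "pure_dim_subvariety V d \<longleftrightarrow> analytic_subvariety V \<and>
     V \<subseteq> closure {p. regular_point_dim V p d} \<and>
     (\<forall>p e. regular_point_dim V p e \<longrightarrow> e = d)"

definition rational_hull :: "nat \<Rightarrow> (complex ^ 'n) set \<Rightarrow> (complex ^ 'n) set" where
  "rational_hull k X = {z. \<forall>V m. m \<le> k \<and> pure_dim_subvariety V (CARD('n) - m) \<and> z \<in> V
        \<longrightarrow> V \<inter> X \<noteq> {}}"

definition cantor_set :: "'a::metric_space set \<Rightarrow> bool" where
  "cantor_set X \<longleftrightarrow> X \<noteq> {} \<and> compact X \<and> (\<forall>x\<in>X. x islimpt X) \<and>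
     (\<forall>x\<in>X. connected_component_set X x = {x})"

end

theory Submission
  imports Defs "HOL-Complex_Analysis.Conformal_Mappings"
begin

text \<open>
  The only property of a positive-dimensional subvariety \<open>V\<close> that matters for the construction is that no
  point of \<open>V\<close> is a local maximum on \<open>V\<close> of the distance to a fixed point \<open>a\<close>.
  Such a \<open>V\<close> cannot stay close to a finite union of spheres: running away from the point antipodal to
  \<open>p \<in> V\<close> on one of the spheres leaves that sphere by a definite amount, and one proceeds with the
  remaining ones. So if a compact set is met by all such \<open>V\<close>, one may cover it by small balls and
  delete thin neighbourhoods of their boundary spheres; a slightly larger set, now cut into small pieces,
  is still met by all of them. Starting from a sphere in the shell, iterating, and retaining finitely
  many marked points at each step to prevent isolated points, one obtains the Cantor set.

  The maximum principle is clear at points through which \<open>V\<close> contains a holomorphic disc.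
  Singular points are handled by stratifying by orders of vanishing: the points of maximal
  order of a defining function lie in a smooth hypersurface, which allows induction on the dimension
  of the submanifold that contains the points under consideration. The induction ends with isolated
  points of a stratum; these are removable for plurisubharmonic functions on \<open>V\<close> because \<open>V\<close> itself has no
  isolated points.
\<close>

subsection \<open>Cantor sets met by all sets without local farthest points\<close>

definition no_local_farthest :: "'a::metric_space set \<Rightarrow> bool" where
  "no_local_farthest V \<longleftrightarrow> closed V \<and>
     (\<forall>a. \<forall>q\<in>V. \<forall>r>0. \<exists>z\<in>V. dist z q < r \<and> dist q a < dist z a)"

text \<open>Take a point of the compact set \<open>V \<inter> cball c r\<close> farthest from
  \<open>a\<close>. Inside the open ball it would be a local farthest point of \<open>V\<close>, so
  it lies on the sphere.\<close>

lemma no_local_farthest_reaches_sphere: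
  fixes V :: "'a::euclidean_space set"
  assumes V: "no_local_farthest V" and p: "p \<in> V" "dist p c \<le> r"
  obtains z where "z \<in> V" "dist z c = r" "dist p a \<le> dist z a"
proof -
  have "compact (V \<inter> cball c r)"
    using V by (simp add: no_local_farthest_def closed_Int_compact)
  moreover have pm: "p \<in> V \<inter> cball c r" using p by (simp add: dist_commute)
  moreover have "continuous_on (V \<inter> cball c r) (\<lambda>z. dist z a)"
    by (intro continuous_intros)
  ultimately obtain z where z: "z \<in> V \<inter> cball c r"
      and zmax: "\<And>y. y \<in> V \<inter> cball c r \<Longrightarrow> dist y a \<le> dist z a"
    using continuous_attains_sup[of "V \<inter> cball c r" "\<lambda>z. dist z a"] by blast
  have "dist z c = r"
  proof (rule ccontr)
    assume "dist z c \<noteq> r"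
    with z have lt: "dist z c < r" by (simp add: dist_commute)
    then obtain y where y: "y \<in> V" "dist y z < r - dist z c" "dist z a < dist y a"
      using V z unfolding no_local_farthest_def by (metis IntD1 diff_gt_0_iff_gt)
    have "dist y c \<le> r" using y(2) dist_triangle[of y c z] by linarith
    then have "y \<in> V \<inter> cball c r" using y(1) by (simp add: dist_commute)
    then show False using zmax y(3) by fastforce
  qed
  then show thesis using that z zmax[OF pm] by blast
qed

lemma no_local_farthest_leaves_sphere:
  fixes V :: "'a::euclidean_space set"
  assumes V: "no_local_farthest V" and p: "p \<in> V" and r: "r \<ge> 0"
  obtains z where "z \<in> V" "dist z p = r" "(dist z t)\<^sup>2 \<ge> (dist p t)\<^sup>2 + r\<^sup>2 / 2"
proof -
  \<comment> \<open>Use the point antipodal to \<open>p\<close> on the sphere around \<open>t\<close> through \<open>p\<close>, together with the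
    parallelogram law.\<close>
  define a where "a = 2 *\<^sub>R t - p"
  obtain z where z: "z \<in> V" "dist z p = r" "dist p a \<le> dist z a"
    using no_local_farthest_reaches_sphere[OF V p, of p r a] r by auto
  have "(dist p a)\<^sup>2 \<le> (dist z a)\<^sup>2" using z(3) by (simp add: power_mono)
  moreover have "(dist z a)\<^sup>2 = 2 * (dist z t)\<^sup>2 + 2 * (dist p t)\<^sup>2 - (dist z p)\<^sup>2"
    unfolding a_def dist_norm power2_norm_eq_inner
    by (simp add: inner_diff inner_commute algebra_simps)
  moreover have "(dist p a)\<^sup>2 = 4 * (dist p t)\<^sup>2"
    unfolding a_def dist_norm power2_norm_eq_inner
    by (simp add: inner_diff inner_commute algebra_simps)
  ultimately show thesis using that z(1,2) by (simp add: field_simps)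
qed

text \<open>The spheres are left one at a time: at most half of \<open>r\<close> is spent on getting
  clear of the sphere about \<open>t\<close>, and the other centres are treated by a movement so
  short that half of this clearance survives. It matters that \<open>\<delta>\<close> depends on
  neither \<open>V\<close> nor \<open>p\<close>.\<close>

lemma no_local_farthest_avoids_spheres:
  fixes T :: "'a::euclidean_space set"
  assumes "finite T" "e > 0" "r > 0"
  obtains \<delta> where "\<delta> > 0"
    "\<And>V p. no_local_farthest V \<Longrightarrow> p \<in> V \<Longrightarrow> \<exists>z\<in>V. dist z p \<le> r \<and> (\<forall>t\<in>T. \<delta> \<le> \<bar>dist z t - e\<bar>)"
proof -
  have "\<exists>\<delta>>0. \<forall>V p. no_local_farthest V \<longrightarrow> p \<in> V \<longrightarrow>
          (\<exists>z\<in>V. dist z p \<le> r \<and> (\<forall>t\<in>T. \<delta> \<le> \<bar>dist z t - e\<bar>))"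
    using \<open>finite T\<close> \<open>r > 0\<close>
  proof (induction T arbitrary: r rule: finite_induct)
    case empty
    show ?case by (rule exI[of _ 1]) (use empty in force)
  next
    case (insert t T)
    \<comment> \<open>The gain \<open>(r/2)\<^sup>2 / 2\<close> in squared distance has to cover
      \<open>(e + c)\<^sup>2 - (e - c)\<^sup>2 = 4 * e * c\<close>; then a point within
      \<open>c\<close> of the sphere is carried to distance at least \<open>e + c\<close> from
      \<open>t\<close>. The bound \<open>c \<le> e\<close> keeps \<open>e - c\<close> nonnegative
      for squaring.\<close>
    define c where "c = min e ((r/2)\<^sup>2 / (8 * e))"
    have c: "0 < c" "c \<le> e" "8 * e * c \<le> (r/2)\<^sup>2"
      using \<open>e > 0\<close> insert.prems by (auto simp: c_def min_def field_simps)
    define s where "s = min (r/2) (c/2)"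
    have s: "0 < s" "s \<le> r/2" "s \<le> c/2" using c insert.prems by (auto simp: s_def)
    obtain \<delta> where \<delta>: "\<delta> > 0" "\<And>V p. no_local_farthest V \<Longrightarrow> p \<in> V \<Longrightarrow>
        \<exists>z\<in>V. dist z p \<le> s \<and> (\<forall>t\<in>T. \<delta> \<le> \<bar>dist z t - e\<bar>)"
      using insert.IH[OF s(1)] by blast
    have "\<exists>z\<in>V. dist z p \<le> r \<and> (\<forall>t\<in>insert t T. min \<delta> (c/2) \<le> \<bar>dist z t - e\<bar>)"
      if V: "no_local_farthest V" and p: "p \<in> V" for V p
    proof -
      have "\<exists>q\<in>V. dist q p \<le> r/2 \<and> c \<le> \<bar>dist q t - e\<bar>"
      proof (cases "c \<le> \<bar>dist p t - e\<bar>")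
        case True then show ?thesis using p insert.prems by force
      next
        case False
        obtain z where z: "z \<in> V" "dist z p = r/2" "(dist z t)\<^sup>2 \<ge> (dist p t)\<^sup>2 + (r/2)\<^sup>2 / 2"
          using no_local_farthest_leaves_sphere[OF V p, of "r/2" t] insert.prems by auto
        have "(e - c)\<^sup>2 \<le> (dist p t)\<^sup>2"
          using False c by (intro power_mono) auto
        moreover have "(e + c)\<^sup>2 = (e - c)\<^sup>2 + 4 * e * c" by (simp add: power2_eq_square algebra_simps)
        ultimately have "(e + c)\<^sup>2 \<le> (dist z t)\<^sup>2" using z(3) c(3) by linarith
        then have "e + c \<le> dist z t" by (rule power2_le_imp_le) simp
        then show ?thesis using z by force
      qed
      then obtain q where q: "q \<in> V" "dist q p \<le> r/2" "c \<le> \<bar>dist q t - e\<bar>" by blast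
      obtain z where z: "z \<in> V" "dist z q \<le> s" "\<forall>t\<in>T. \<delta> \<le> \<bar>dist z t - e\<bar>"
        using \<delta>(2)[OF V q(1)] by blast
      have "dist z p \<le> r" using z(2) q(2) s(2) dist_triangle[of z p q] by linarith
      moreover have "c/2 \<le> \<bar>dist z t - e\<bar>"
        using q(3) z(2) s(3) abs_dist_diff_le[of z t q] unfolding dist_commute[of t q] by linarith
      ultimately show ?thesis using z by (force simp: min_le_iff_disj)
    qed
    moreover have "min \<delta> (c/2) > 0" using \<delta>(1) c(1) by simp
    ultimately show ?case by blast
  qed
  then show thesis using that by blast
qed

section \<open>Refinement into small pieces\<close>

lemma bounded_open_finite_net:
  fixes A :: "'a::euclidean_space set"
  assumes "open A" "bounded A" "\<epsilon> > 0"
  obtains F where "finite F" "F \<subseteq> A" "\<And>x. x \<in> A \<Longrightarrow> \<exists>y\<in>F. y \<noteq> x \<and> dist x y < \<epsilon>"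
proof -
  have "compact (closure A)" using assms(2) by (simp add: compact_closure)
  moreover have "closure A \<subseteq> \<Union> ((\<lambda>t. ball t (\<epsilon>/2)) ` A)"
  proof
    fix x assume "x \<in> closure A"
    then obtain t where "t \<in> A" "dist t x < \<epsilon>/2"
      using assms(3) closure_approachable[of x A] half_gt_zero by blast
    then show "x \<in> \<Union> ((\<lambda>t. ball t (\<epsilon>/2)) ` A)" by auto
  qed
  ultimately obtain T where T: "T \<subseteq> A" "finite T" "closure A \<subseteq> \<Union> ((\<lambda>t. ball t (\<epsilon>/2)) ` T)"
    using compactE_image[of "closure A" A "\<lambda>t. ball t (\<epsilon>/2)"] by auto
  \<comment> \<open>Every centre gets a companion \<open>g t\<close>, which serves the case that
    \<open>x\<close> is itself the centre. Neighbours distinct from \<open>x\<close> are what later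
    excludes isolated points.\<close>
  have "\<exists>y. y \<in> A \<and> y \<noteq> t \<and> dist y t < \<epsilon>/2" if "t \<in> A" for t
  proof -
    have "t islimpt A" using that assms(1) by (simp add: interior_limit_point interior_open)
    then show ?thesis using half_gt_zero[OF assms(3)] unfolding islimpt_approachable by metis
  qed
  then obtain g where g: "\<And>t. t \<in> A \<Longrightarrow> g t \<in> A \<and> g t \<noteq> t \<and> dist (g t) t < \<epsilon>/2" by metis
  show thesis
  proof
    show "finite (T \<union> g ` T)" "T \<union> g ` T \<subseteq> A" using T g by auto
    fix x assume "x \<in> A"
    then obtain t where t: "t \<in> T" "dist t x < \<epsilon>/2" using T(3) closure_subset[of A] by auto
    have gt: "g t \<noteq> t" "dist (g t) t < \<epsilon>/2" using g t T(1) by auto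
    show "\<exists>y\<in>T \<union> g ` T. y \<noteq> x \<and> dist x y < \<epsilon>"
    proof (cases "t = x")
      case True
      then show ?thesis using t gt assms(3) by (intro bexI[of _ "g t"]) (auto simp: dist_commute)
    next
      case False
      moreover have "dist x t < \<epsilon>" using t(2) assms(3) by (simp add: dist_commute)
      ultimately show ?thesis using t(1) by blast
    qed
  qed
qed

text \<open>The compact witness keeps a positive distance from the complement of an open
  \<open>A\<close>; this margin is the room in which points of the sets \<open>V\<close> are moved
  during a refinement.\<close>

definition blocks :: "'a::topological_space set set \<Rightarrow> 'a set \<Rightarrow> bool" where
  "blocks \<V> A \<longleftrightarrow> (\<exists>K. compact K \<and> K \<subseteq> A \<and> (\<forall>V\<in>\<V>. V \<inter> K \<noteq> {}))"

text \<open>The function \<open>c\<close> labels the pieces.\<close>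
definition splits_small :: "real \<Rightarrow> 'a::metric_space set \<Rightarrow> bool" where
  "splits_small \<epsilon> A \<longleftrightarrow> (\<exists>\<eta>>0. \<exists>c :: 'a \<Rightarrow> 'a set. \<forall>x\<in>A. \<forall>y\<in>A.
     (dist x y < \<eta> \<longrightarrow> c x = c y) \<and> (c x = c y \<longrightarrow> dist x y < \<epsilon>))"

text \<open>Labels are locally constant on \<open>A\<close>, hence constant on connected subsets.
  This yields total disconnectedness in the limit.\<close>

lemma splits_small_connected:
  assumes "splits_small \<epsilon> A" "connected C" "C \<subseteq> A" "x \<in> C" "y \<in> C"
  shows "dist x y < \<epsilon>"
proof -
  obtain \<eta> and c :: "'a \<Rightarrow> 'a set" where c: "\<eta> > 0"
     "\<And>x y. x \<in> A \<Longrightarrow> y \<in> A \<Longrightarrow> dist x y < \<eta> \<Longrightarrow> c x = c y"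
     "\<And>x y. x \<in> A \<Longrightarrow> y \<in> A \<Longrightarrow> c x = c y \<Longrightarrow> dist x y < \<epsilon>"
    using assms(1) unfolding splits_small_def by blast
  have "c x = c y"
  proof (rule connected_equivalence_relation[OF assms(2,4,5), where R = "\<lambda>x y. c x = c y"])
    fix a assume "a \<in> C"
    then show "\<exists>T. openin (top_of_set C) T \<and> a \<in> T \<and> (\<forall>x\<in>T. c a = c x)"
      using c(1,2) assms(3)
      by (intro exI[of _ "C \<inter> ball a \<eta>"]) (auto simp: openin_open_Int subset_iff)
  qed auto
  then show ?thesis using c(3) assms by blast
qed

text \<open>A thin neighbourhood of a compact blocker and the marked points is covered by balls of
  one radius \<open>e\<close>, and narrow shells around their boundary spheres are deleted. A point
  of \<open>V\<close> in the blocker can be moved within the neighbourhood to a point of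
  \<open>V\<close> clear of all shells, so blocking persists.\<close>

lemma refine_blocking_set:
  fixes A :: "'a::euclidean_space set"
  assumes A: "open A" "bounded A" "blocks \<V> A" and F: "finite F" "F \<subseteq> A" and "\<epsilon> > 0"
    and \<V>: "\<And>V. V \<in> \<V> \<Longrightarrow> no_local_farthest V"
  obtains A' F' where "open A'" "closure A' \<subseteq> A" "blocks \<V> A'" "finite F'" "F \<subseteq> F'" "F' \<subseteq> A'"
    "splits_small \<epsilon> A'" "\<And>x. x \<in> A \<Longrightarrow> \<exists>y\<in>F'. y \<noteq> x \<and> dist x y < \<epsilon>"
proof -
  obtain F1 where F1: "finite F1" "F1 \<subseteq> A" "\<And>x. x \<in> A \<Longrightarrow> \<exists>y\<in>F1. y \<noteq> x \<and> dist x y < \<epsilon>"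
    using bounded_open_finite_net[OF A(1,2) \<open>\<epsilon> > 0\<close>] by blast
  define F' where "F' = F \<union> F1"
  have F': "finite F'" "F' \<subseteq> A" using F F1 by (auto simp: F'_def)
  obtain K0 where K0: "compact K0" "K0 \<subseteq> A" "\<And>V. V \<in> \<V> \<Longrightarrow> V \<inter> K0 \<noteq> {}"
    using A(3) unfolding blocks_def by blast
  define K where "K = K0 \<union> F'"
  have K: "compact K" "K \<subseteq> A" using K0 F' by (auto simp: K_def finite_imp_compact compact_Un)
  show thesis
  \<comment> \<open>The empty case is separate because \<open>infdist x {}\<close> is 0 by
    convention and would not measure closeness to \<open>K\<close>.\<close>
  proof (cases "K = {}")
    case True
    then have "A = {}" "\<V> = {}" "F = {}" using F1 K0 by (auto simp: K_def F'_def)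
    then show thesis
      using that[of "{}" "{}"] by (auto simp: blocks_def splits_small_def intro: zero_less_one)
  next
    case False
    obtain \<tau> where \<tau>: "\<tau> > 0" "\<And>x. infdist x K \<le> \<tau> \<Longrightarrow> x \<in> A"
    proof -
      obtain e where e: "e > 0" "{x. infdist x K \<le> e} \<subseteq> A"
        using compact_in_open_separated[OF False K(1) A(1) K(2)] by blast
      show thesis using that[of e] e by auto
    qed
    define N where "N = {x. infdist x K \<le> \<tau>}"
    have cN: "closed N" unfolding N_def
      by (intro closed_Collect_le continuous_intros)
    have N: "compact N" "N \<subseteq> A"
      using \<tau>(2) A(2) cN by (auto simp: N_def compact_eq_bounded_closed intro: bounded_subset)
    have "N \<subseteq> \<Union> ((\<lambda>t. ball t (\<epsilon>/8)) ` N)" using \<open>\<epsilon> > 0\<close> by auto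
    then obtain T where T: "T \<subseteq> N" "finite T" "N \<subseteq> \<Union> ((\<lambda>t. ball t (\<epsilon>/8)) ` T)"
      using compactE_image[OF N(1), of N "\<lambda>t. ball t (\<epsilon>/8)"] by auto
    \<comment> \<open>A generic radius puts no marked point on a boundary sphere. Above
      \<open>\<epsilon>/8\<close> the balls still cover \<open>N\<close>; below
      \<open>\<epsilon>/4\<close> two points of one ball are closer than
      \<open>\<epsilon>\<close>.\<close>
    have "infinite ({\<epsilon>/8<..<\<epsilon>/4} - (\<lambda>(f,t). dist f t) ` (F' \<times> T))"
      using F' T \<open>\<epsilon> > 0\<close> by (intro Diff_infinite_finite) (auto simp: infinite_Ioo)
    then obtain e where "e \<in> {\<epsilon>/8<..<\<epsilon>/4} - (\<lambda>(f,t). dist f t) ` (F' \<times> T)"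
      using infinite_imp_nonempty by blast
    then have e: "\<epsilon>/8 < e" "e < \<epsilon>/4" "\<And>f t. f \<in> F' \<Longrightarrow> t \<in> T \<Longrightarrow> dist f t \<noteq> e" by force+
    obtain \<delta>0 where \<delta>0: "\<delta>0 > 0" "\<And>V p. no_local_farthest V \<Longrightarrow> p \<in> V \<Longrightarrow>
         \<exists>z\<in>V. dist z p \<le> \<tau>/2 \<and> (\<forall>t\<in>T. \<delta>0 \<le> \<bar>dist z t - e\<bar>)"
      using no_local_farthest_avoids_spheres[OF T(2), of e "\<tau>/2"] e \<open>\<epsilon> > 0\<close> \<tau>(1) by auto
    \<comment> \<open>Lowering \<open>\<delta>0\<close> to the least clearance of a marked point
      saves the marked points from deletion.\<close>
    define \<delta> where "\<delta> = Min (insert \<delta>0 ((\<lambda>(f,t). \<bar>dist f t - e\<bar>) ` (F' \<times> T)))"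
    have fin: "finite (insert \<delta>0 ((\<lambda>(f,t). \<bar>dist f t - e\<bar>) ` (F' \<times> T)))" using F' T by auto
    have \<delta>: "\<delta> > 0" "\<delta> \<le> \<delta>0" "\<And>f t. f \<in> F' \<Longrightarrow> t \<in> T \<Longrightarrow> \<delta> \<le> \<bar>dist f t - e\<bar>"
    proof -
      show "\<delta> > 0" unfolding \<delta>_def using fin \<delta>0(1) e(3) by (subst Min_gr_iff) auto
      show "\<delta> \<le> \<delta>0" unfolding \<delta>_def using fin by (intro Min_le) auto
      fix f t assume "f \<in> F'" "t \<in> T"
      then show "\<delta> \<le> \<bar>dist f t - e\<bar>" unfolding \<delta>_def using fin by (intro Min_le) auto
    qed
    \<comment> \<open>The thresholds of \<open>L\<close> are stricter than those of
      \<open>A'\<close>, so that \<open>L\<close> can be closed, hence compact, and still lie in the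
      open set \<open>A'\<close>.\<close>
    define A' where "A' = {x. infdist x K < \<tau>} \<inter> (\<Inter>t\<in>T. {x. \<delta>/2 < \<bar>dist x t - e\<bar>})"
    define L where "L = {x. infdist x K \<le> \<tau>/2} \<inter> (\<Inter>t\<in>T. {x. \<delta> \<le> \<bar>dist x t - e\<bar>})"
    have "A' \<subseteq> N" by (auto simp: A'_def N_def)
    show thesis
    proof
      show "open A'" unfolding A'_def using T(2)
        by (intro open_Int open_INT open_Collect_less continuous_intros ballI)
      show "closure A' \<subseteq> A"
        using \<open>A' \<subseteq> N\<close> N(2) closure_minimal[OF _ cN] by blast
      show "finite F'" "F \<subseteq> F'" using F' by (auto simp: F'_def)
      show "F' \<subseteq> A'"
      proof
        fix f assume f: "f \<in> F'"
        have "\<delta>/2 < \<bar>dist f t - e\<bar>" if "t \<in> T" for t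
          using \<delta>(1) \<delta>(3)[OF f that] by linarith
        moreover have "infdist f K = 0" using f by (simp add: K_def)
        ultimately show "f \<in> A'" using \<tau>(1) by (simp add: A'_def)
      qed
      show "blocks \<V> A'" unfolding blocks_def
      proof (intro exI conjI ballI)
        have "closed L" unfolding L_def
          by (intro closed_Int closed_INT closed_Collect_le continuous_intros ballI)
        moreover have "L \<subseteq> N" using \<tau>(1) by (auto simp: L_def N_def)
        ultimately show "compact L" using N(1) by (metis compact_Int_closed inf.absorb_iff2)
        show "L \<subseteq> A'" using \<delta>(1) \<tau>(1) by (force simp: L_def A'_def)
        fix V assume V: "V \<in> \<V>"
        then obtain p where p: "p \<in> V" "p \<in> K0" using K0(3) by blast
        obtain z where z: "z \<in> V" "dist z p \<le> \<tau>/2" "\<forall>t\<in>T. \<delta>0 \<le> \<bar>dist z t - e\<bar>"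
          using \<delta>0(2)[OF \<V>[OF V] p(1)] by blast
        have "infdist z K \<le> \<tau>/2" using infdist_le[of p K z] p z(2) by (simp add: K_def)
        then have "z \<in> L" using z(3) \<delta>(2) by (force simp: L_def)
        then show "V \<inter> L \<noteq> {}" using z(1) by blast
      qed
      \<comment> \<open>The label of a point is the set of centres whose ball of radius
        \<open>e\<close> contains it. Opposite sides of one of the spheres are more than
        \<open>\<delta>\<close> apart in \<open>A'\<close>, so \<open>\<delta>\<close> serves as
        \<open>\<eta>\<close>.\<close>
      show "splits_small \<epsilon> A'" unfolding splits_small_def
      proof (intro exI conjI ballI impI)
        show "\<delta> > 0" by fact
        fix x y assume xy: "x \<in> A'" "y \<in> A'"
        {
          assume "dist x y < \<delta>"
          have "dist x t < e \<longleftrightarrow> dist y t < e" if "t \<in> T" for t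
          proof -
            have "\<delta>/2 < \<bar>dist x t - e\<bar>" "\<delta>/2 < \<bar>dist y t - e\<bar>"
              using xy that by (auto simp: A'_def)
            then show ?thesis
              using \<open>dist x y < \<delta>\<close> dist_triangle[of x t y] dist_triangle[of y t x]
              by (simp add: dist_commute abs_if split: if_splits)
          qed
          then show "{t\<in>T. dist x t < e} = {t\<in>T. dist y t < e}" by blast
        }
        assume eq: "{t\<in>T. dist x t < e} = {t\<in>T. dist y t < e}"
        obtain t where "t \<in> T" "dist x t < e"
          using T(3) \<open>A' \<subseteq> N\<close> xy(1) e(1) by (fastforce simp: dist_commute)
        moreover from this eq have "dist y t < e" by blast
        ultimately show "dist x y < \<epsilon>"
          using e(2) \<open>\<epsilon> > 0\<close> dist_triangle2[of x y t] by linarith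
      qed
      show "\<exists>y\<in>F'. y \<noteq> x \<and> dist x y < \<epsilon>" if "x \<in> A" for x using F1(3)[OF that] by (auto simp: F'_def)
    qed
  qed
qed

text \<open>Refine at the scales \<open>1 / Suc n\<close> and intersect. Nested compactness
  preserves blocking, the marked points survive in the limit and accumulate at each of its points,
  and connected components have diameter zero.\<close>

lemma cantor_set_blocking:
  fixes A :: "'a::euclidean_space set"
  assumes A: "open A" "bounded A" "A \<noteq> {}" "blocks \<V> A"
    and \<V>: "\<And>V. V \<in> \<V> \<Longrightarrow> no_local_farthest V"
  obtains X where "cantor_set X" "X \<subseteq> A" "\<And>V. V \<in> \<V> \<Longrightarrow> V \<inter> X \<noteq> {}"
proof -
  \<comment> \<open>A state is a pair of an open set and its finite set of marked points;
    \<open>P\<close> is the invariant and \<open>Q\<close> the refinement relation.\<close>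
  define P where "P = (\<lambda>(n::nat) (B :: 'a set, F :: 'a set).
    open B \<and> B \<subseteq> A \<and> B \<noteq> {} \<and> blocks \<V> B \<and> finite F \<and> F \<subseteq> B)"
  define Q where "Q = (\<lambda>n (B :: 'a set, F :: 'a set) (B', F'). closure B' \<subseteq> B \<and> F \<subseteq> F' \<and>
     splits_small (1 / Suc n) B' \<and> (\<forall>x\<in>B. \<exists>y\<in>F'. y \<noteq> x \<and> dist x y < 1 / Suc n))"
  have "\<exists>f. \<forall>n. P n (f n) \<and> Q n (f n) (f (Suc n))"
  proof (rule dependent_nat_choice)
    show "\<exists>x. P 0 x" using A by (intro exI[of _ "(A, {})"]) (simp add: P_def)
  next
    fix x n assume "P n x"
    moreover obtain B F where x: "x = (B, F)" by force
    ultimately have P: "open B" "blocks \<V> B" "finite F" "F \<subseteq> B" "B \<subseteq> A" "B \<noteq> {}"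
      by (auto simp: P_def)
    have bdd: "bounded B" using P(5) A(2) bounded_subset by blast
    have pos: "1 / real (Suc n) > 0" by simp
    obtain B' F' where B': "open B'" "closure B' \<subseteq> B" "blocks \<V> B'" "finite F'" "F \<subseteq> F'" "F' \<subseteq> B'"
       "splits_small (1 / Suc n) B'" "\<And>x. x \<in> B \<Longrightarrow> \<exists>y\<in>F'. y \<noteq> x \<and> dist x y < 1 / Suc n"
      by (rule refine_blocking_set[OF P(1) bdd P(2-4) pos \<V>]) auto
    have "B' \<noteq> {}" using B'(6) B'(8) P(6) by fastforce
    moreover have "B' \<subseteq> A" using B'(2) P(5) closure_subset[of B'] by blast
    ultimately show "\<exists>y. P (Suc n) y \<and> Q n x y"
      unfolding x using B' by (intro exI[of _ "(B', F')"]) (auto simp: P_def Q_def)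
  qed
  then obtain f where f: "\<And>n. P n (f n)" "\<And>n. Q n (f n) (f (Suc n))" by blast
  define B where "B n = fst (f n)" for n
  define F where "F n = snd (f n)" for n
  have B: "B n \<subseteq> A" "B n \<noteq> {}" "blocks \<V> (B n)" "F n \<subseteq> B n" for n
    using f(1)[of n] by (auto simp: P_def B_def F_def split: prod.splits)
  have BS: "closure (B (Suc n)) \<subseteq> B n" "F n \<subseteq> F (Suc n)" "splits_small (1 / Suc n) (B (Suc n))"
      "\<And>x. x \<in> B n \<Longrightarrow> \<exists>y\<in>F (Suc n). y \<noteq> x \<and> dist x y < 1 / Suc n" for n
    using f(2)[of n] by (auto simp: Q_def B_def F_def split: prod.splits)
  have B_anti: "B n \<subseteq> B m" if "m \<le> n" for m n
    using that by (rule lift_Suc_antimono_le[rotated]) (meson BS(1) closure_subset subset_trans)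
  have F_mono: "F m \<subseteq> F n" if "m \<le> n" for m n
    using that BS(2) by (rule lift_Suc_mono_le[rotated])
  \<comment> \<open>Closures make \<open>X\<close> compact, and since each closure lies in the
    preceding open set, \<open>X\<close> still lies in every \<open>B n\<close>.\<close>
  define X where "X = (\<Inter>n. closure (B n))"
  have XB: "X \<subseteq> B n" for n using BS(1)[of n] by (auto simp: X_def)
  have compB: "compact (closure (B n))" for n
    using B(1)[of n] A(2) bounded_subset compact_closure by blast
  have FX: "F n \<subseteq> X" for n
  proof -
    have "F n \<subseteq> B m" for m
      using F_mono[of n "max n m"] B(4)[of "max n m"] B_anti[of m "max n m"] by auto
    then show ?thesis unfolding X_def using closure_subset by (meson INT_greatest subset_trans)
  qed
  have small: "\<exists>n. 1 / Suc n < \<epsilon>" if "\<epsilon> > 0" for \<epsilon> :: real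
    using nat_approx_posE[OF that] by metis
  show thesis
  proof
    show "X \<subseteq> A" using XB B(1) by blast
    show "V \<inter> X \<noteq> {}" if V: "V \<in> \<V>" for V
    proof -
      have "(\<Inter>n. V \<inter> closure (B n)) \<noteq> {}"
      proof (rule compact_nest)
        show "compact (V \<inter> closure (B n))" for n
          using \<V>[OF V] compB by (auto simp: no_local_farthest_def intro: closed_Int_compact)
        show "V \<inter> closure (B n) \<noteq> {}" for n
          using B(3)[of n] V closure_subset[of "B n"] unfolding blocks_def by blast
        show "V \<inter> closure (B n) \<subseteq> V \<inter> closure (B m)" if "m \<le> n" for m n
          using closure_mono[OF B_anti[OF that]] by blast
      qed
      then show ?thesis by (auto simp: X_def)
    qed
    show "cantor_set X" unfolding cantor_set_def
    proof (intro conjI ballI)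
      obtain x where "x \<in> B 0" using B(2) by blast
      then show "X \<noteq> {}" using BS(4)[of x 0] FX[of 1] by auto
      show "compact X" unfolding X_def using compB by (intro compact_Inter) auto
      fix x assume x: "x \<in> X"
      show "x islimpt X" unfolding islimpt_approachable
      proof (intro allI impI)
        fix \<epsilon> :: real assume "\<epsilon> > 0"
        then obtain n where n: "1 / Suc n < \<epsilon>" using small by blast
        obtain y where "y \<in> F (Suc n)" "y \<noteq> x" "dist x y < 1 / Suc n" using BS(4) XB x by blast
        then show "\<exists>y\<in>X. y \<noteq> x \<and> dist y x < \<epsilon>"
          using FX n by (intro bexI[of _ y]) (auto simp: dist_commute)
      qed
      have "y = x" if "y \<in> connected_component_set X x" for y
      proof (rule ccontr)
        assume "y \<noteq> x"
        then obtain n where n: "1 / Suc n < dist x y" using small[of "dist x y"] by auto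
        have "connected_component_set X x \<subseteq> B (Suc n)" using connected_component_subset XB by blast
        from splits_small_connected[OF BS(3) connected_connected_component this _ that]
        have "dist x y < 1 / Suc n" using x by auto
        then show False using n by simp
      qed
      then show "connected_component_set X x = {x}" using x by auto
    qed
  qed
qed

text \<open>The initial blocker is the sphere of radius \<open>R\<close> halfway through the shell:
  a set \<open>V\<close> that starts in the unit ball must reach it.\<close>

lemma cantor_set_blocking_shell:
  fixes \<rho> :: real
  assumes "\<rho> > 1"
  obtains X :: "'a::euclidean_space set"
    where "cantor_set X" "X \<subseteq> {z. 1 < norm z \<and> norm z < \<rho>}"
      "\<And>V. no_local_farthest V \<Longrightarrow> V \<inter> cball 0 1 \<noteq> {} \<Longrightarrow> V \<inter> X \<noteq> {}"
proof -
  define A :: "'a set" where "A = {z. 1 < norm z \<and> norm z < \<rho>}"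
  define \<V> :: "'a set set" where "\<V> = {V. no_local_farthest V \<and> V \<inter> cball 0 1 \<noteq> {}}"
  define R where "R = (1 + \<rho>) / 2"
  have R: "1 < R" "R < \<rho>" using assms by (auto simp: R_def)
  have sub: "sphere 0 R \<subseteq> A" using R by (auto simp: A_def)
  have "open A" unfolding A_def by (intro open_Collect_conj open_Collect_less continuous_intros)
  moreover have "bounded A" unfolding bounded_iff A_def by (intro exI[of _ \<rho>]) auto
  moreover have "A \<noteq> {}" using sub R sphere_eq_empty[of "0::'a" R] by auto
  moreover have "blocks \<V> A" unfolding blocks_def
  proof (intro exI conjI ballI)
    show "compact (sphere (0::'a) R)" by simp
    show "sphere 0 R \<subseteq> A" by fact
    fix V assume "V \<in> \<V>"
    then obtain p where p: "no_local_farthest V" "p \<in> V" "norm p \<le> 1" by (auto simp: \<V>_def)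
    then obtain z where "z \<in> V" "dist z 0 = R"
      using no_local_farthest_reaches_sphere[OF p(1,2), of 0 R 0] R by auto
    then show "V \<inter> sphere 0 R \<noteq> {}" by auto
  qed
  moreover have "\<And>V. V \<in> \<V> \<Longrightarrow> no_local_farthest V" by (simp add: \<V>_def)
  ultimately obtain X where "cantor_set X" "X \<subseteq> A" "\<And>V. V \<in> \<V> \<Longrightarrow> V \<inter> X \<noteq> {}"
    using cantor_set_blocking[of A \<V>] by auto
  then show thesis using that[of X] by (auto simp: \<V>_def A_def)
qed

subsection \<open>Holomorphic functions of several variables\<close>

lemma axis_add: "axis j (s + t) = axis j s + (axis j t :: complex ^ 'n)"
  by (simp add: axis_def vec_eq_iff)

lemma axis_0: "axis j 0 = (0 :: complex ^ 'n)"
  by (simp add: axis_eq_0_iff)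

lemma axis_smult: "axis j (c * t) = c *s (axis j t :: complex ^ 'n)"
  by (simp add: axis_def vec_eq_iff)

lemma bounded_linear_axis: "bounded_linear (axis j :: complex \<Rightarrow> complex ^ 'n)"
  by (rule linear_conv_bounded_linear[THEN iffD1], rule linearI)
     (simp_all add: axis_def vec_eq_iff)

lemma norm_axis: "norm (axis j t :: complex ^ 'n) = cmod t"
proof -
  have "(\<Sum>i\<in>UNIV. (cmod (axis j t $ i))\<^sup>2) = (\<Sum>i\<in>UNIV. if i = j then (cmod t)\<^sup>2 else 0)"
    by (intro sum.cong) (auto simp: axis_def)
  then show ?thesis by (simp add: norm_vec_def L2_set_def)
qed

definition pd :: "'n \<Rightarrow> (complex ^ 'n \<Rightarrow> complex) \<Rightarrow> complex ^ 'n \<Rightarrow> complex" where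
  "pd j f z = deriv (\<lambda>t. f (z + axis j t)) 0"

lemma deriv_slice: "deriv (\<lambda>t. f (z + axis j t)) t = pd j f (z + axis j t)"
  unfolding pd_def by (subst deriv_shift_0) (simp add: o_def axis_add add.assoc)

lemma cderiv_at_slice:
  assumes "cderiv_at f f' (z + axis j t)"
  shows "((\<lambda>t. f (z + axis j t)) has_field_derivative f' (axis j 1)) (at t)"
proof -
  have f': "(f has_derivative f') (at (z + axis j t))" "\<And>c v. f' (c *s v) = c * f' v"
    using assms by (auto simp: cderiv_at_def)
  have "((\<lambda>t. z + axis j t) has_derivative (\<lambda>h. 0 + axis j h)) (at t)"
    by (intro derivative_intros bounded_linear_imp_has_derivative bounded_linear_axis)
  from diff_chain_at[OF this f'(1)]
  have "((\<lambda>t. f (z + axis j t)) has_derivative (\<lambda>h. f' (axis j h))) (at t)" by (simp add: o_def)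
  moreover have "(\<lambda>h. f' (axis j h)) = (*) (f' (axis j 1))"
  proof
    fix h show "f' (axis j h) = f' (axis j 1) * h"
      using f'(2)[of h "axis j 1"] unfolding axis_smult[of j h 1, symmetric] by simp
  qed
  ultimately show ?thesis by (simp add: has_field_derivative_def)
qed

lemma cderiv_at_eq_sum:
  assumes "cderiv_at f f' z"
  shows "f' v = (\<Sum>j\<in>UNIV. v $ j * pd j f z)"
proof -
  have f': "(f has_derivative f') (at z)" "\<And>c v. f' (c *s v) = c * f' v"
    using assms by (auto simp: cderiv_at_def)
  have "f' (axis j 1) = pd j f z" for j
    using DERIV_imp_deriv[OF cderiv_at_slice[of f f' z j 0]] assms by (simp add: pd_def axis_0)
  moreover have "f' v = f' (\<Sum>j\<in>UNIV. v $ j *s axis j 1)" by (simp add: basis_expansion)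
  ultimately show ?thesis
    by (simp add: linear_sum[OF has_derivative_linear[OF f'(1)]] f'(2) del: vec.scale_eq_0_iff)
qed

lemma holo_CN_open: "holo_CN f U \<Longrightarrow> open U"
  by (simp add: holo_CN_def)

lemma holo_CN_subset: "holo_CN f U \<Longrightarrow> open W \<Longrightarrow> W \<subseteq> U \<Longrightarrow> holo_CN f W"
  by (auto simp: holo_CN_def)

lemma holo_CN_continuous: "holo_CN f U \<Longrightarrow> continuous_on U f"
  unfolding holo_CN_def cderiv_at_def
  by (meson continuous_at_imp_continuous_on has_derivative_continuous)

lemma holo_CN_slice:
  assumes "holo_CN f U" "\<And>t. t \<in> S \<Longrightarrow> z + axis j t \<in> U"
  shows "(\<lambda>t. f (z + axis j t)) holomorphic_on S"
  unfolding holomorphic_on_def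
proof
  fix t assume "t \<in> S"
  then obtain f' where "cderiv_at f f' (z + axis j t)" using assms unfolding holo_CN_def by blast
  then show "(\<lambda>t. f (z + axis j t)) field_differentiable at t within S"
    using cderiv_at_slice field_differentiable_at_within field_differentiable_def by blast
qed

section \<open>Total derivatives and Cauchy's integral formula\<close>

definition total_deriv :: "(complex ^ 'n \<Rightarrow> complex) \<Rightarrow> complex ^ 'n \<Rightarrow> (complex ^ 'n) \<Rightarrow>\<^sub>L complex" where
  "total_deriv f z = Blinfun (\<lambda>v. \<Sum>j\<in>UNIV. v $ j * pd j f z)"

lemma total_deriv_apply: "blinfun_apply (total_deriv f z) v = (\<Sum>j\<in>UNIV. v $ j * pd j f z)"
proof -
  have "bounded_linear (\<lambda>v::complex^'a. \<Sum>j\<in>UNIV. v $ j * pd j f z)"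
    by (intro bounded_linear_sum bounded_linear_mult_const bounded_linear_vec_nth)
  then show ?thesis by (simp add: total_deriv_def bounded_linear_Blinfun_apply)
qed

lemma total_deriv_smult: "blinfun_apply (total_deriv f z) (c *s v) = c * blinfun_apply (total_deriv f z) v"
  by (simp add: total_deriv_apply sum_distrib_left mult.assoc)

lemma holo_CN_has_total_deriv:
  assumes "holo_CN f U" "z \<in> U"
  shows "(f has_derivative blinfun_apply (total_deriv f z)) (at z)"
proof -
  obtain f' where f': "cderiv_at f f' z" using assms by (auto simp: holo_CN_def)
  then have "f' = blinfun_apply (total_deriv f z)"
    by (auto simp: total_deriv_apply cderiv_at_eq_sum)
  then show ?thesis using f' by (simp add: cderiv_at_def)
qed

text \<open>Cauchy's formula for the first derivative on a circle in the \<open>j\<close>-th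
  coordinate line. As an integral over a fixed interval it can be studied as a function of all
  coordinates of \<open>z\<close>; the exponential weight collects the circle's derivative and the
  squared denominator.\<close>

lemma pd_eq_integral:
  assumes f: "holo_CN f U" and r: "r > 0" and U: "\<And>t. cmod t \<le> r \<Longrightarrow> z + axis j t \<in> U"
  shows "pd j f z = integral (cbox 0 1)
    (\<lambda>s. f (z + axis j (circlepath 0 r s)) * (exp (- (2 * of_real pi * \<i> * of_real s)) / of_real r))"
proof -
  have hol: "(\<lambda>t. f (z + axis j t)) holomorphic_on cball 0 r"
    using U by (intro holo_CN_slice[OF f]) simp
  have "((\<lambda>t. f (z + axis j t)) has_field_derivative
     (1 / (2 * of_real pi * \<i>) * contour_integral (circlepath 0 r) (\<lambda>u. f (z + axis j u) / (u-0)^2))) (at 0)"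
    using hol r by (intro Cauchy_derivative_integral_circlepath holomorphic_on_imp_continuous_on)
       (auto intro: holomorphic_on_subset[of _ "cball 0 r"])
  then have "pd j f z = 1 / (2 * of_real pi * \<i>) * contour_integral (circlepath 0 r) (\<lambda>u. f (z + axis j u) / u^2)"
    unfolding pd_def by (simp add: DERIV_imp_deriv)
  also have "\<dots> = integral {0..1} (\<lambda>s. 1 / (2 * of_real pi * \<i>) * (f (z + axis j (circlepath 0 r s)) / (circlepath 0 r s)^2
        * (2 * pi * \<i> * r * exp(2 * of_real pi * \<i> * s))))"
    unfolding contour_integral_integral vector_derivative_circlepath by (simp only: integral_mult_right)
  also have "\<dots> = integral {0..1} (\<lambda>s. f (z + axis j (circlepath 0 r s)) * (exp (- (2 * of_real pi * \<i> * of_real s)) / of_real r))"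
    using r by (intro integral_cong) (simp add: circlepath power2_eq_square exp_minus field_simps)
  finally show ?thesis by simp
qed

lemma pd_circle_setup:
  assumes "open U" "z0 \<in> (U :: (complex ^ 'n) set)"
  obtains r where "r > 0" "\<And>z t. z \<in> ball z0 r \<Longrightarrow> cmod t \<le> r \<Longrightarrow> z + axis j t \<in> U"
proof -
  obtain e where e: "e > 0" "ball z0 e \<subseteq> U" using assms open_contains_ball by blast
  show thesis
  proof (rule that[of "e/2"])
    fix z and t :: complex assume zt: "z \<in> ball z0 (e/2)" "cmod t \<le> e/2"
    have "dist z0 (z + axis j t) \<le> dist z0 z + norm (axis j t)"
      using dist_triangle[of z0 "z + axis j t" z] by (simp add: dist_norm)
    also have "\<dots> < e" using zt by (simp add: norm_axis)
    finally show "z + axis j t \<in> U" using e by auto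
  qed (use e in auto)
qed

lemma continuous_on_translate_circle:
  fixes g :: "complex ^ 'n \<Rightarrow> 'b::topological_space"
  assumes g: "continuous_on U g" and U: "\<And>z t. z \<in> B \<Longrightarrow> cmod t \<le> r \<Longrightarrow> z + axis j t \<in> U" and r: "r > 0"
  shows "continuous_on (B \<times> cbox 0 1) (\<lambda>x. g (fst x + axis j (circlepath 0 r (snd x))))"
proof (rule continuous_on_compose2[OF g])
  show "continuous_on (B \<times> cbox 0 1) (\<lambda>x. fst x + axis j (circlepath 0 r (snd x)))"
    unfolding circlepath
    by (intro continuous_intros linear_continuous_on_compose[OF _ bounded_linear.linear[OF bounded_linear_axis]])
  show "(\<lambda>x. fst x + axis j (circlepath 0 r (snd x))) ` (B \<times> cbox 0 1) \<subseteq> U"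
    using U r by (auto simp: circlepath norm_mult)
qed

lemma pd_continuous:
  assumes "holo_CN f U"
  shows "continuous_on U (pd j f)"
proof (rule continuous_at_imp_continuous_on, rule ballI)
  fix z0 assume z0: "z0 \<in> U"
  obtain r where r: "r > 0" "\<And>z t. z \<in> ball z0 r \<Longrightarrow> cmod t \<le> r \<Longrightarrow> z + axis j t \<in> U"
    using pd_circle_setup[OF holo_CN_open[OF assms] z0] by blast
  have "continuous_on (ball z0 r) (\<lambda>z. integral (cbox 0 1)
    (\<lambda>s. f (z + axis j (circlepath 0 r s)) * (exp (- (2 * of_real pi * \<i> * of_real s)) / of_real r)))"
  proof (rule integral_continuous_on_param)
    have "continuous_on (ball z0 r \<times> cbox 0 1) (\<lambda>x. f (fst x + axis j (circlepath 0 r (snd x))) *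
        (exp (- (2 * of_real pi * \<i> * of_real (snd x))) / of_real r))"
      using r(1)
      by (intro continuous_on_mult continuous_on_translate_circle[OF holo_CN_continuous[OF assms] r(2) r(1)])
         (auto intro!: continuous_intros)
    then show "continuous_on (ball z0 r \<times> cbox 0 1) (\<lambda>(z, s). f (z + axis j (circlepath 0 r s)) *
        (exp (- (2 * of_real pi * \<i> * of_real s)) / of_real r))"
      by (simp add: split_beta)
  qed
  then have "continuous_on (ball z0 r) (pd j f)"
    by (rule continuous_on_eq) (rule pd_eq_integral[OF assms r(1) r(2), symmetric])
  then show "isCont (pd j f) z0" using r(1) by (simp add: continuous_on_eq_continuous_at)
qed

lemma total_deriv_continuous:
  assumes "holo_CN f U"
  shows "continuous_on U (total_deriv f)"
  by (intro continuous_on_blinfun_componentwise)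
     (simp add: total_deriv_apply, intro continuous_intros pd_continuous[OF assms])

text \<open>Differentiate the Cauchy integral under the integral sign. The Leibniz rule wants the
  derivative of the integrand as a continuous family of bounded linear maps, here
  \<open>fx\<close>.\<close>

lemma holo_CN_pd:
  assumes f: "holo_CN f U"
  shows "holo_CN (pd j f) U"
  unfolding holo_CN_def
proof (intro conjI ballI)
  show "open U" using f by (simp add: holo_CN_def)
  fix z0 assume z0: "z0 \<in> U"
  obtain r where r: "r > 0" "\<And>z t. z \<in> ball z0 r \<Longrightarrow> cmod t \<le> r \<Longrightarrow> z + axis j t \<in> U"
    using pd_circle_setup[OF holo_CN_open[OF f] z0] by blast
  define w where "w = circlepath 0 r"
  define k where "k s = exp (- (2 * of_real pi * \<i> * of_real s)) / complex_of_real r" for s :: real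
  have w: "cmod (w s) \<le> r" for s using r by (simp add: w_def circlepath norm_mult)
  define fx where "fx z s = blinfun_mult_left (k s) o\<^sub>L total_deriv f (z + axis j (w s))" for z s
  have contk: "continuous_on S (\<lambda>x. k (g x))" if "continuous_on S g" for S and g :: "'b::topological_space \<Rightarrow> real"
    unfolding k_def using r that by (intro continuous_intros) auto
  have int: "pd j f z = integral (cbox 0 1) (\<lambda>s. f (z + axis j (w s)) * k s)" if "z \<in> ball z0 r" for z
    unfolding w_def k_def using pd_eq_integral[OF f r(1) r(2)[OF that]] by simp
  have "((\<lambda>z. integral (cbox 0 1) (\<lambda>s. f (z + axis j (w s)) * k s)) has_derivative
      blinfun_apply (integral (cbox 0 1) (fx z0))) (at z0 within ball z0 r)"
  proof (rule leibniz_rule)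
    fix z s assume z: "z \<in> ball z0 r" and s: "s \<in> cbox (0::real) 1"
    have "((\<lambda>z. z + axis j (w s)) has_derivative (\<lambda>v. v)) (at z)"
      by (auto intro!: derivative_eq_intros)
    from diff_chain_at[OF this holo_CN_has_total_deriv[OF f r(2)[OF z w]]]
    have "((\<lambda>z. f (z + axis j (w s))) has_derivative blinfun_apply (total_deriv f (z + axis j (w s)))) (at z)"
      by (simp add: o_def)
    then have "((\<lambda>z. f (z + axis j (w s)) * k s) has_derivative
        (\<lambda>v. blinfun_apply (total_deriv f (z + axis j (w s))) v * k s)) (at z)"
      by (rule has_derivative_mult_left)
    moreover have "blinfun_apply (fx z s) = (\<lambda>v. blinfun_apply (total_deriv f (z + axis j (w s))) v * k s)"
      by (simp add: fx_def fun_eq_iff)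
    ultimately show "((\<lambda>z. f (z + axis j (w s)) * k s) has_derivative blinfun_apply (fx z s)) (at z within ball z0 r)"
      by (simp add: has_derivative_at_withinI)
  next
    have c1: "continuous_on (ball z0 r \<times> cbox 0 1) (\<lambda>x. f (fst x + axis j (w (snd x))))"
      unfolding w_def
      by (rule continuous_on_translate_circle[OF holo_CN_continuous[OF f] r(2) r(1)])
    show "(\<lambda>s. f (z + axis j (w s)) * k s) integrable_on cbox 0 1" if "z \<in> ball z0 r" for z
    proof (intro integrable_continuous continuous_intros contk)
      show "continuous_on (cbox 0 1) (\<lambda>s. f (z + axis j (w s)))"
      proof -
        have "continuous_on (cbox 0 1) (\<lambda>s::real. (z, s))" by (intro continuous_intros)
        from continuous_on_compose2[OF c1 this] show ?thesis using that by fastforce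
      qed
    qed
    show "continuous_on (ball z0 r \<times> cbox 0 1) (\<lambda>(z, s). fx z s)"
      unfolding fx_def split_beta w_def
      by (intro continuous_intros contk bounded_linear.continuous_on[OF bounded_linear_blinfun_mult_left]
         continuous_on_translate_circle[OF total_deriv_continuous[OF f] r(2) r(1)])
  qed (use r in auto)
  then have "((\<lambda>z. integral (cbox 0 1) (\<lambda>s. f (z + axis j (w s)) * k s)) has_derivative
      blinfun_apply (integral (cbox 0 1) (fx z0))) (at z0)"
    using r(1) by (subst (asm) at_within_open) auto
  then have D: "(pd j f has_derivative blinfun_apply (integral (cbox 0 1) (fx z0))) (at z0)"
    by (rule has_derivative_transform_within_open[where s = "ball z0 r"]) (use r(1) int in auto)
  \<comment> \<open>Continuity of \<open>fx z0\<close> lets evaluation at a vector commute with the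
    integral, so complex linearity passes from the integrand to the derivative.\<close>
  have "(\<lambda>s. z0 + axis j (w s)) ` cbox 0 1 \<subseteq> U" using r w by auto
  then have "continuous_on (cbox 0 1) (fx z0)"
    unfolding fx_def w_def circlepath
    by (intro continuous_intros contk bounded_linear.continuous_on[OF bounded_linear_blinfun_mult_left]
          continuous_on_compose2[OF total_deriv_continuous[OF f]] bounded_linear.continuous_on[OF bounded_linear_axis])
       (auto simp: w_def circlepath)
  then have "fx z0 integrable_on cbox 0 1" by (rule integrable_continuous)
  then have "blinfun_apply (integral (cbox 0 1) (fx z0)) v = integral (cbox 0 1) (\<lambda>s. blinfun_apply (fx z0 s) v)" for v
    by (rule blinfun_apply_integral)
  then have "blinfun_apply (integral (cbox 0 1) (fx z0)) (c *s v) = c * blinfun_apply (integral (cbox 0 1) (fx z0)) v" for c v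
    by (simp add: fx_def total_deriv_smult mult.assoc del: cbox_interval)
  then show "\<exists>f'. cderiv_at (pd j f) f' z0" using D unfolding cderiv_at_def by blast
qed

section \<open>Holomorphic maps and smooth zero sets\<close>

definition holo_map :: "(complex ^ 'n \<Rightarrow> complex ^ 'n) \<Rightarrow> (complex ^ 'n) set \<Rightarrow> bool" where
  "holo_map G U \<longleftrightarrow> open U \<and>
     (\<forall>z\<in>U. \<exists>L. (G has_derivative L) (at z) \<and> (\<forall>c v. L (c *s v) = c *s L v))"

lemma holo_map_continuous: "holo_map G U \<Longrightarrow> continuous_on U G"
  unfolding holo_map_def
  by (meson continuous_at_imp_continuous_on has_derivative_continuous)

lemma holo_map_open_vimage:
  assumes "holo_map G U" "open W"
  shows "open {z\<in>U. G z \<in> W}"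
proof -
  have "open (U \<inter> G -` W)"
    using assms holo_map_continuous continuous_open_preimage[of U G W] by (auto simp: holo_map_def)
  moreover have "{z\<in>U. G z \<in> W} = U \<inter> G -` W" by auto
  ultimately show ?thesis by simp
qed

lemma holo_CN_compose:
  assumes f: "holo_CN f W" and G: "holo_map G U"
  shows "holo_CN (\<lambda>z. f (G z)) {z\<in>U. G z \<in> W}"
  unfolding holo_CN_def
proof (intro conjI ballI)
  show "open {z\<in>U. G z \<in> W}" using holo_map_open_vimage[OF G holo_CN_open[OF f]] .
  fix z assume z: "z \<in> {z\<in>U. G z \<in> W}"
  obtain L where L: "(G has_derivative L) (at z)" "\<And>c v. L (c *s v) = c *s L v"
    using G z by (auto simp: holo_map_def)
  obtain f' where f': "(f has_derivative f') (at (G z))" "\<And>c v. f' (c *s v) = c * f' v"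
    using f z by (auto simp: holo_CN_def cderiv_at_def)
  have "cderiv_at (\<lambda>z. f (G z)) (\<lambda>v. f' (L v)) z"
    using diff_chain_at[OF L(1) f'(1)] L(2) f'(2) by (simp add: cderiv_at_def o_def)
  then show "\<exists>f'. cderiv_at (\<lambda>z. f (G z)) f' z" by blast
qed

lemma holo_map_compose:
  assumes H: "holo_map H W" and G: "holo_map G U"
  shows "holo_map (\<lambda>z. H (G z)) {z\<in>U. G z \<in> W}"
  unfolding holo_map_def
proof (intro conjI ballI)
  show "open {z\<in>U. G z \<in> W}" using holo_map_open_vimage[OF G] H by (auto simp: holo_map_def)
  fix z assume z: "z \<in> {z\<in>U. G z \<in> W}"
  obtain L where L: "(G has_derivative L) (at z)" "\<And>c v. L (c *s v) = c *s L v"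
    using G z by (auto simp: holo_map_def)
  obtain M where M: "(H has_derivative M) (at (G z))" "\<And>c v. M (c *s v) = c *s M v"
    using H z by (auto simp: holo_map_def)
  show "\<exists>L. ((\<lambda>z. H (G z)) has_derivative L) (at z) \<and> (\<forall>c v. L (c *s v) = c *s L v)"
    using diff_chain_at[OF L(1) M(1)] L(2) M(2) by (intro exI[of _ "\<lambda>v. M (L v)"]) (simp add: o_def)
qed

lemma holo_map_subset: "holo_map G U \<Longrightarrow> open W \<Longrightarrow> W \<subseteq> U \<Longrightarrow> holo_map G W"
  by (auto simp: holo_map_def)

lemma holo_CN_nth: "holo_CN (\<lambda>z. z $ j) UNIV"
  unfolding holo_CN_def cderiv_at_def
  by (auto intro!: exI[of _ "\<lambda>v. v $ j"] bounded_linear_imp_has_derivative bounded_linear_vec_nth)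

text \<open>The map overwrites the \<open>j\<close>-th coordinate by \<open>g z\<close>; writing it
  as a correction of the identity makes its derivative immediate.\<close>

lemma holo_map_replace:
  assumes g: "holo_CN g U"
  shows "holo_map (\<lambda>z. z + axis j (g z - z $ j)) U"
  unfolding holo_map_def
proof (intro conjI ballI)
  show "open U" using g by (rule holo_CN_open)
  fix z assume "z \<in> U"
  then obtain g' where g': "(g has_derivative g') (at z)" "\<And>c v. g' (c *s v) = c * g' v"
    using g by (auto simp: holo_CN_def cderiv_at_def)
  have "((\<lambda>z. z + axis j (g z - z $ j)) has_derivative (\<lambda>v. v + axis j (g' v - v $ j))) (at z)"
    by (intro derivative_intros g' bounded_linear.has_derivative[OF bounded_linear_axis]
          bounded_linear.has_derivative[OF bounded_linear_vec_nth])
  moreover have "c *s v + axis j (g' (c *s v) - (c *s v) $ j) = c *s (v + axis j (g' v - v $ j))" for c v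
    using g'(2) by (simp add: vec.scale_right_distrib axis_smult[symmetric] right_diff_distrib)
  ultimately show "\<exists>L. ((\<lambda>z. z + axis j (g z - z $ j)) has_derivative L) (at z) \<and> (\<forall>c v. L (c *s v) = c *s L v)"
    by blast
qed

text \<open>The inverse function theorem for the map that replaces the \<open>j\<close>-th coordinate by \<open>D\<close>.\<close>
lemma holo_CN_zero_set_graph:
  fixes D :: "complex ^ 'n \<Rightarrow> complex"
  assumes D: "holo_CN D U" and q: "q \<in> U" "D q = 0" "pd j D q \<noteq> 0"
  obtains N W G where "open N" "q \<in> N" "holo_map G W" "q - axis j (q $ j) \<in> W"
    "\<And>z. z \<in> N \<Longrightarrow> D z = 0 \<Longrightarrow> G (z - axis j (z $ j)) = z"
proof -
  define d where "d = pd j D q"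
  have d0: "d \<noteq> 0" using q by (simp add: d_def)
  define \<Psi> where "\<Psi> z = z + axis j (D z - z $ j)" for z
  define a where "a = Blinfun (axis j :: complex \<Rightarrow> complex ^ 'n)"
  define e where "e = Blinfun (\<lambda>v :: complex ^ 'n. v $ j)"
  have a: "blinfun_apply a = axis j" unfolding a_def
    by (rule bounded_linear_Blinfun_apply[OF bounded_linear_axis])
  have e: "blinfun_apply e = (\<lambda>v. v $ j)" unfolding e_def
    by (rule bounded_linear_Blinfun_apply[OF bounded_linear_vec_nth])
  define \<Psi>' where "\<Psi>' z = id_blinfun + (a o\<^sub>L (total_deriv D z - e))" for z
  have \<Psi>': "blinfun_apply (\<Psi>' z) v = v + axis j (total_deriv D z v - v $ j)" for z v
    by (simp add: \<Psi>'_def blinfun.add_left blinfun.diff_left a e)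
  have Daxis: "total_deriv D z (axis j s) = s * pd j D z" for z s
    by (simp add: total_deriv_apply axis_def if_distrib[of "\<lambda>x. x * _"] cong: if_cong)
  have \<Psi>'_smult: "blinfun_apply (\<Psi>' z) (c *s v) = c *s blinfun_apply (\<Psi>' z) v" for z c v
    by (simp add: \<Psi>' total_deriv_smult vec.scale_right_distrib axis_smult[symmetric] right_diff_distrib)
  \<comment> \<open>An explicit inverse of \<open>\<Psi>' q\<close>: if
    \<open>w = \<Psi>' q v\<close> differs from \<open>v\<close> by \<open>s\<close> in coordinate
    \<open>j\<close>, then \<open>w $ j - total_deriv D q w\<close> equals \<open>- s * d\<close>,
    and division by \<open>d\<close> gives the correction \<open>- s\<close>.\<close>
  define \<Phi> where "\<Phi> = id_blinfun + (a o\<^sub>L (blinfun_mult_left (1 / d) o\<^sub>L (e - total_deriv D q)))"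
  have \<Phi>: "blinfun_apply \<Phi> w = w + axis j ((w $ j - total_deriv D q w) / d)" for w
    by (simp add: \<Phi>_def blinfun.add_left blinfun.diff_left a e)
  have inv: "\<Phi> o\<^sub>L \<Psi>' q = id_blinfun"
  proof (rule blinfun_eqI)
    fix v
    define s where "s = total_deriv D q v - v $ j"
    have "(v + axis j s) $ j = v $ j + s" by (simp add: axis_def)
    moreover have "total_deriv D q (v + axis j s) = total_deriv D q v + s * d"
      by (simp add: blinfun.add_right Daxis d_def)
    ultimately have "blinfun_apply \<Phi> (v + axis j s) = v + axis j s + axis j ((v $ j + s - (total_deriv D q v + s * d)) / d)"
      by (simp only: \<Phi>)
    also have "(v $ j + s - (total_deriv D q v + s * d)) / d = - s"
      using d0 by (simp add: s_def field_simps)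
    also have "v + axis j s + axis j (- s) = v" by (simp add: axis_def vec_eq_iff)
    finally show "blinfun_apply (\<Phi> o\<^sub>L \<Psi>' q) v = blinfun_apply id_blinfun v"
      by (simp add: \<Psi>' s_def)
  qed
  obtain N W G G' where N: "open N" "N \<subseteq> U" "q \<in> N" "open W" "\<Psi> q \<in> W" "homeomorphism N W \<Psi> G"
     and G': "\<And>y. y \<in> W \<Longrightarrow> (G has_derivative (G' y)) (at y)"
       "\<And>y. y \<in> W \<Longrightarrow> G' y = inv (blinfun_apply (\<Psi>' (G y)))"
       "\<And>y. y \<in> W \<Longrightarrow> bij (blinfun_apply (\<Psi>' (G y)))"
  proof (rule inverse_function_theorem[of U \<Psi> \<Psi>' q \<Phi>])
    show "open U" using D by (rule holo_CN_open)
    show "q \<in> U" by fact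
    show "\<Phi> o\<^sub>L \<Psi>' q = id_blinfun" by fact
    show "continuous_on U \<Psi>'" unfolding \<Psi>'_def
      by (intro continuous_intros total_deriv_continuous[OF D])
    fix x assume x: "x \<in> U"
    have "(\<Psi> has_derivative (\<lambda>v. v + axis j (total_deriv D x v - v $ j))) (at x)" unfolding \<Psi>_def
      by (intro derivative_intros holo_CN_has_total_deriv[OF D x] bounded_linear.has_derivative[OF bounded_linear_axis]
          bounded_linear.has_derivative[OF bounded_linear_vec_nth])
    then show "(\<Psi> has_derivative blinfun_apply (\<Psi>' x)) (at x)" by (simp add: \<Psi>'[abs_def])
  qed blast
  \<comment> \<open>On the zero set of \<open>D\<close>, \<open>\<Psi>\<close> just sets coordinate
    \<open>j\<close> to 0, so its local inverse recovers that coordinate from the others.\<close>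
  have \<Psi>0: "\<Psi> z = z - axis j (z $ j)" if "D z = 0" for z
    using that by (simp add: \<Psi>_def axis_def vec_eq_iff)
  show thesis
  proof
    show "open N" "q \<in> N" by fact+
    show "q - axis j (q $ j) \<in> W" using N(5) \<Psi>0 q(2) by simp
    show "G (z - axis j (z $ j)) = z" if "z \<in> N" "D z = 0" for z
      using that N(6) \<Psi>0 by (metis homeomorphism_apply1)
    show "holo_map G W" unfolding holo_map_def
    proof (intro conjI ballI)
      fix y assume y: "y \<in> W"
      have "G' y (c *s v) = c *s G' y v" for c v
        unfolding G'(2)[OF y] using G'(3)[OF y] \<Psi>'_smult
        by (metis bij_inv_eq_iff)
      then show "\<exists>L. (G has_derivative L) (at y) \<and> (\<forall>c v. L (c *s v) = c *s L v)"
        using G'(1)[OF y] by blast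
    qed fact
  qed
qed

subsection \<open>The maximum principle on analytic sets\<close>

text \<open>The standard Hermitian product, with the conjugate in the second argument so that it is
  holomorphic in the first.\<close>

definition cin :: "complex ^ 'n \<Rightarrow> complex ^ 'n \<Rightarrow> complex" where
  "cin z w = (\<Sum>i\<in>UNIV. z $ i * cnj (w $ i))"

lemma cin_self: "cin z z = of_real ((norm z)\<^sup>2)"
proof -
  have "cin z z = of_real (\<Sum>i\<in>UNIV. (cmod (z $ i))\<^sup>2)"
    unfolding cin_def of_real_sum by (intro sum.cong) (simp_all add: complex_norm_square del: of_real_power)
  also have "(\<Sum>i\<in>UNIV. (cmod (z $ i))\<^sup>2) = (norm z)\<^sup>2"
    by (simp add: norm_vec_def L2_set_def sum_nonneg)
  finally show ?thesis .
qed

lemma Re_cin: "Re (cin z w) = z \<bullet> w"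
  by (simp add: cin_def inner_vec_def inner_complex_def)

lemma cin_smult_left: "cin (c *s z) w = c * cin z w"
  by (simp add: cin_def sum_distrib_left mult.assoc)

lemma norm_smult: "norm (c *s (z :: complex ^ 'n)) = cmod c * norm z"
proof -
  have "of_real ((norm (c *s z))\<^sup>2) = (of_real ((cmod c)\<^sup>2 * (norm z)\<^sup>2) :: complex)"
    unfolding cin_self[symmetric]
    by (simp add: cin_def cin_self[symmetric] complex_norm_square sum_distrib_left algebra_simps del: of_real_power)
  then have "(norm (c *s z))\<^sup>2 = (cmod c * norm z)\<^sup>2" unfolding of_real_eq_iff by (simp add: power_mult_distrib)
  then show ?thesis by (simp add: power2_eq_iff_nonneg)
qed

text \<open>Rotating \<open>z\<close> by a unimodular scalar makes the product real and nonnegative;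
  the real Cauchy-Schwarz inequality then applies.\<close>

lemma cin_Cauchy_Schwarz: "cmod (cin z w) \<le> norm z * norm w"
proof -
  obtain c where c: "cmod c = 1" "c * cin z w = of_real (cmod (cin z w))"
  proof (cases "cin z w = 0")
    case False
    then show thesis
      by (intro that[of "of_real (cmod (cin z w)) / cin z w"]) (simp_all add: norm_divide)
  qed (use that[of 1] in simp)
  have "cmod (cin z w) = Re (cin (c *s z) w)" by (simp add: cin_smult_left c(2))
  also have "\<dots> \<le> norm (c *s z) * norm w" unfolding Re_cin by (rule norm_cauchy_schwarz)
  finally show ?thesis by (simp add: norm_smult c(1))
qed

lemma holo_CN_cin: "holo_CN (\<lambda>z. cin (z + a) w) UNIV"
  unfolding holo_CN_def cderiv_at_def
proof (intro conjI ballI exI[of _ "\<lambda>v. cin v w"] allI)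
  fix z :: "complex ^ 'a"
  have "((\<lambda>z. \<Sum>i\<in>UNIV. (z + a) $ i * cnj (w $ i)) has_derivative (\<lambda>v. \<Sum>i\<in>UNIV. v $ i * cnj (w $ i))) (at z)"
    by (intro has_derivative_sum has_derivative_mult_left
        has_derivative_eq_rhs[OF bounded_linear.has_derivative[OF bounded_linear_vec_nth]])
       (auto intro!: derivative_eq_intros)
  then show "((\<lambda>z. cin (z + a) w) has_derivative (\<lambda>v. cin v w)) (at z)"
    by (simp add: cin_def[abs_def])
qed (auto simp: cin_smult_left)

section \<open>Plurisubharmonic kernels and peak points\<close>

lemma holo_CN_const: "holo_CN (\<lambda>z. c) UNIV"
  unfolding holo_CN_def cderiv_at_def by (auto intro!: exI[of _ "\<lambda>v. 0"])

lemma holo_CN_add: "holo_CN f U \<Longrightarrow> holo_CN g U \<Longrightarrow> holo_CN (\<lambda>z. f z + g z) U"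
  unfolding holo_CN_def cderiv_at_def
proof (intro conjI ballI; elim conjE)
  fix z assume "z \<in> U" "\<forall>z\<in>U. \<exists>f'. (f has_derivative f') (at z) \<and> (\<forall>c v. f' (c *s v) = c * f' v)"
    "\<forall>z\<in>U. \<exists>f'. (g has_derivative f') (at z) \<and> (\<forall>c v. f' (c *s v) = c * f' v)"
  then obtain f' g' where *: "(f has_derivative f') (at z)" "\<And>c v. f' (c *s v) = c * f' v"
     "(g has_derivative g') (at z)" "\<And>c v. g' (c *s v) = c * g' v" by metis
  then show "\<exists>f'. ((\<lambda>z. f z + g z) has_derivative f') (at z) \<and> (\<forall>c v. f' (c *s v) = c * f' v)"
    by (intro exI[of _ "\<lambda>v. f' v + g' v"]) (auto intro!: derivative_intros simp: distrib_left)
qed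

lemma holo_CN_mult: "holo_CN f U \<Longrightarrow> holo_CN g U \<Longrightarrow> holo_CN (\<lambda>z. f z * g z) U"
  unfolding holo_CN_def cderiv_at_def
proof (intro conjI ballI; elim conjE)
  fix z assume "z \<in> U" "\<forall>z\<in>U. \<exists>f'. (f has_derivative f') (at z) \<and> (\<forall>c v. f' (c *s v) = c * f' v)"
    "\<forall>z\<in>U. \<exists>f'. (g has_derivative f') (at z) \<and> (\<forall>c v. f' (c *s v) = c * f' v)"
  then obtain f' g' where *: "(f has_derivative f') (at z)" "\<And>c v. f' (c *s v) = c * f' v"
     "(g has_derivative g') (at z)" "\<And>c v. g' (c *s v) = c * g' v" by metis
  then show "\<exists>f'. ((\<lambda>z. f z * g z) has_derivative f') (at z) \<and> (\<forall>c v. f' (c *s v) = c * f' v)"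
    by (intro exI[of _ "\<lambda>v. f z * g' v + f' v * g z"]) (auto intro!: derivative_intros simp: distrib_left)
qed

text \<open>A kernel \<open>K z w = (\<Sum>i. F\<^sub>i z * cnj (F\<^sub>i w))\<close> with entire \<open>F\<^sub>i\<close> is the model case; its diagonal is
  the plurisubharmonic function \<open>\<Sum>i. \<bar>F\<^sub>i z\<bar>\<^sup>2\<close>. Only the Cauchy-Schwarz inequality is kept.\<close>
definition psh_kernel :: "(complex ^ 'n \<Rightarrow> complex ^ 'n \<Rightarrow> complex) \<Rightarrow> bool" where
  "psh_kernel K \<longleftrightarrow> (\<forall>w. holo_CN (\<lambda>z. K z w) UNIV) \<and> continuous_on UNIV (\<lambda>z. K z z) \<and>
     (\<forall>z. K z z = of_real (Re (K z z)) \<and> 0 \<le> Re (K z z)) \<and>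
     (\<forall>z w. (cmod (K z w))\<^sup>2 \<le> Re (K z z) * Re (K w w))"

lemma psh_kernel_cin: "psh_kernel (\<lambda>z w. cin (z + a) (w + a))"
  unfolding psh_kernel_def cin_self
proof (intro conjI allI)
  show "(cmod (cin (z + a) (w + a)))\<^sup>2 \<le> Re (of_real ((norm (z + a))\<^sup>2)) * Re (of_real ((norm (w + a))\<^sup>2))" for z w
    using power_mono[OF cin_Cauchy_Schwarz[of "z + a" "w + a"], of 2] by (simp add: power_mult_distrib)
qed (auto simp: holo_CN_cin intro!: continuous_intros)

lemma psh_kernel_const: "c \<ge> 0 \<Longrightarrow> psh_kernel (\<lambda>z w. of_real c)"
  unfolding psh_kernel_def by (auto simp: holo_CN_const power2_eq_square)

lemma psh_kernel_mult:
  assumes K: "psh_kernel K" and L: "psh_kernel L"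
  shows "psh_kernel (\<lambda>z w. K z w * L z w)"
proof -
  have *: "Re (K z z * L z z) = Re (K z z) * Re (L z z)" for z
    using K L unfolding psh_kernel_def by (metis Re_complex_of_real of_real_mult)
  show ?thesis unfolding psh_kernel_def *
  proof (intro conjI allI)
    show "holo_CN (\<lambda>z. K z w * L z w) UNIV" for w
      using K L by (intro holo_CN_mult) (auto simp: psh_kernel_def)
    show "continuous_on UNIV (\<lambda>z. K z z * L z z)"
      using K L by (intro continuous_intros) (auto simp: psh_kernel_def)
    show "K z z * L z z = of_real (Re (K z z) * Re (L z z))" for z
      using K L unfolding psh_kernel_def by (metis of_real_mult)
    show "0 \<le> Re (K z z) * Re (L z z)" for z using K L by (auto simp: psh_kernel_def)
    show "(cmod (K z w * L z w))\<^sup>2 \<le> Re (K z z) * Re (L z z) * (Re (K w w) * Re (L w w))" for z w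
    proof -
      have "(cmod (K z w))\<^sup>2 * (cmod (L z w))\<^sup>2 \<le> (Re (K z z) * Re (K w w)) * (Re (L z z) * Re (L w w))"
        using K L by (intro mult_mono) (auto simp: psh_kernel_def)
      then show ?thesis by (simp add: norm_mult power_mult_distrib algebra_simps)
    qed
  qed
qed

text \<open>The Cauchy-Schwarz bound for the sum follows from the one for the plane vectors
  \<open>(sqrt a, sqrt c)\<close> and \<open>(sqrt b, sqrt d)\<close>.\<close>

lemma psh_kernel_add:
  assumes K: "psh_kernel K" and L: "psh_kernel L"
  shows "psh_kernel (\<lambda>z w. K z w + L z w)"
  unfolding psh_kernel_def
proof (intro conjI allI)
  show "holo_CN (\<lambda>z. K z w + L z w) UNIV" for w
    using K L by (intro holo_CN_add) (auto simp: psh_kernel_def)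
  show "continuous_on UNIV (\<lambda>z. K z z + L z z)"
    using K L by (intro continuous_intros) (auto simp: psh_kernel_def)
  show "K z z + L z z = of_real (Re (K z z + L z z))" for z
    using K L unfolding psh_kernel_def by (metis of_real_add plus_complex.sel(1))
  show "0 \<le> Re (K z z + L z z)" for z using K L by (auto simp: psh_kernel_def)
  fix z w
  define a b c d where "a = Re (K z z)" and "b = Re (K w w)" and "c = Re (L z z)" and "d = Re (L w w)"
  have nn: "a \<ge> 0" "b \<ge> 0" "c \<ge> 0" "d \<ge> 0" using K L by (auto simp: psh_kernel_def a_def b_def c_def d_def)
  have k: "cmod (K z w) \<le> sqrt a * sqrt b"
    using K unfolding psh_kernel_def a_def b_def real_sqrt_mult[symmetric] by (simp add: real_le_rsqrt)
  have l: "cmod (L z w) \<le> sqrt c * sqrt d"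
    using L unfolding psh_kernel_def c_def d_def real_sqrt_mult[symmetric] by (simp add: real_le_rsqrt)
  have "(cmod (K z w + L z w))\<^sup>2 \<le> (sqrt a * sqrt b + sqrt c * sqrt d)\<^sup>2"
    using norm_triangle_ineq[of "K z w" "L z w"] k l by (intro power_mono) (linarith, simp)
  also have "\<dots> \<le> ((sqrt a)\<^sup>2 + (sqrt c)\<^sup>2) * ((sqrt b)\<^sup>2 + (sqrt d)\<^sup>2)"
    using zero_le_power2[of "sqrt a * sqrt d - sqrt c * sqrt b"] by (simp add: power2_eq_square algebra_simps)
  finally show "(cmod (K z w + L z w))\<^sup>2 \<le> Re (K z z + L z z) * Re (K w w + L w w)"
    using nn by (simp add: a_def b_def c_def d_def)
qed

lemma psh_kernel_power: "psh_kernel K \<Longrightarrow> psh_kernel (\<lambda>z w. K z w ^ n)"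
  using psh_kernel_const[of 1] by (induction n) (auto intro: psh_kernel_mult)

lemma psh_kernel_scale: "psh_kernel K \<Longrightarrow> c \<ge> 0 \<Longrightarrow> psh_kernel (\<lambda>z w. of_real c * K z w)"
  by (intro psh_kernel_mult psh_kernel_const)

lemma psh_kernel_Re_power: "psh_kernel K \<Longrightarrow> Re (K z z ^ n) = Re (K z z) ^ n"
  unfolding psh_kernel_def by (metis Re_complex_of_real of_real_power)

lemma psh_kernel_Re_mult: "psh_kernel K \<Longrightarrow> psh_kernel L \<Longrightarrow> Re (K z z * L z z) = Re (K z z) * Re (L z z)"
  unfolding psh_kernel_def by (metis Re_complex_of_real of_real_mult)

text \<open>In the model case this is the nonnegativity of the squared distance between the values
  of \<open>F\<close> at \<open>z\<close> and \<open>w\<close>; in general it comes from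
  Cauchy-Schwarz and the arithmetic-geometric mean inequality.\<close>

lemma psh_kernel_polarization:
  assumes "psh_kernel K"
  shows "2 * Re (K z w) \<le> Re (K z z) + Re (K w w)"
proof -
  have nn: "0 \<le> Re (K z z)" "0 \<le> Re (K w w)" "(cmod (K z w))\<^sup>2 \<le> Re (K z z) * Re (K w w)"
    using assms by (auto simp: psh_kernel_def)
  have "cmod (K z w) \<le> sqrt (Re (K z z) * Re (K w w))" using nn(3) by (rule real_le_rsqrt)
  also have "\<dots> \<le> (Re (K z z) + Re (K w w)) / 2" by (rule arith_geo_mean_sqrt) (use nn in auto)
  finally have "2 * cmod (K z w) \<le> Re (K z z) + Re (K w w)" by simp
  then show ?thesis using complex_Re_le_cmod[of "K z w"] by linarith
qed

definition no_peak_at :: "(complex ^ 'n) set \<Rightarrow> complex ^ 'n \<Rightarrow> bool" where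
  "no_peak_at V q \<longleftrightarrow> (\<forall>K \<delta> r. psh_kernel K \<longrightarrow> \<delta> > 0 \<longrightarrow> r > 0 \<longrightarrow>
     (\<exists>z\<in>V. dist z q < r \<and> Re (K q q) + \<delta> * (norm q)\<^sup>2 < Re (K z z) + \<delta> * (norm z)\<^sup>2))"

text \<open>At a peak, Cauchy-Schwarz bounds the holomorphic function
  \<open>L (\<gamma> t) q\<close> by its value at 0, so the maximum modulus principle makes it
  constant. Polarization then bounds \<open>\<delta> * (norm (\<gamma> t - q))\<^sup>2\<close> by
  0.\<close>

lemma no_peak_at_disc:
  fixes \<gamma> :: "complex \<Rightarrow> complex ^ 'n"
  assumes e: "e > 0" and \<gamma>0: "\<gamma> 0 = q"
    and hol: "\<And>f. holo_CN f UNIV \<Longrightarrow> (\<lambda>t. f (\<gamma> t)) holomorphic_on ball 0 e"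
    and cont: "continuous_on (ball 0 e) \<gamma>"
    and V: "\<And>t. t \<in> ball 0 e \<Longrightarrow> \<gamma> t \<in> V"
    and nonconst: "\<And>t. t \<in> ball 0 e \<Longrightarrow> t \<noteq> 0 \<Longrightarrow> \<gamma> t \<noteq> q"
  shows "no_peak_at V q"
  unfolding no_peak_at_def
proof (intro allI impI, rule ccontr)
  fix K :: "complex ^ 'n \<Rightarrow> complex ^ 'n \<Rightarrow> complex" and \<delta> r :: real
  assume K: "psh_kernel K" and \<delta>: "\<delta> > 0" and r: "r > 0"
  assume "\<not> (\<exists>z\<in>V. dist z q < r \<and> Re (K q q) + \<delta> * (norm q)\<^sup>2 < Re (K z z) + \<delta> * (norm z)\<^sup>2)"
  then have peak: "Re (K z z) + \<delta> * (norm z)\<^sup>2 \<le> Re (K q q) + \<delta> * (norm q)\<^sup>2" if "z \<in> V" "dist z q < r" for z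
    using that by force
  define L where "L z w = K z w + of_real \<delta> * cin (z + 0) (w + 0)" for z w
  have L: "psh_kernel L" unfolding L_def using K \<delta>
    by (intro psh_kernel_add psh_kernel_scale psh_kernel_cin) auto
  have L_diag: "Re (L z z) = Re (K z z) + \<delta> * (norm z)\<^sup>2" for z by (simp add: L_def cin_self)
  define h where "h t = L (\<gamma> t) q" for t
  have "\<forall>\<^sub>F t in at 0. dist (\<gamma> t) q < r"
    using cont e \<gamma>0 r by (metis centre_in_ball continuous_on_eq_continuous_at isCont_def open_ball tendstoD)
  then obtain e' where e': "e' > 0" "\<And>t. t \<noteq> 0 \<Longrightarrow> dist t 0 < e' \<Longrightarrow> dist (\<gamma> t) q < r"
    unfolding eventually_at by blast
  define s where "s = min e e'"
  have s: "s > 0" "s \<le> e" using e e' by (auto simp: s_def)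
  have near: "dist (\<gamma> t) q < r" if "t \<in> ball 0 s" for t
    using that e'(2)[of t] \<gamma>0 r by (cases "t = 0") (auto simp: s_def)
  have le: "Re (L (\<gamma> t) (\<gamma> t)) \<le> Re (L q q)" if "t \<in> ball 0 s" for t
    using peak[OF V near[OF that]] that s by (simp add: L_diag)
  have hol_h: "h holomorphic_on ball 0 e"
    unfolding h_def using L by (intro hol) (simp add: psh_kernel_def)
  have Lqq: "L q q = of_real (Re (L q q))" "Re (L q q) \<ge> 0" using L by (auto simp: psh_kernel_def)
  have "cmod (h t) \<le> cmod (h 0)" if t: "t \<in> ball 0 s" for t
  proof (rule power2_le_imp_le)
    have "(cmod (h t))\<^sup>2 \<le> Re (L (\<gamma> t) (\<gamma> t)) * Re (L q q)"
      unfolding h_def using L by (simp add: psh_kernel_def)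
    also have "\<dots> \<le> Re (L q q) * Re (L q q)" using le[OF t] Lqq by (intro mult_right_mono)
    also have "\<dots> = (cmod (h 0))\<^sup>2"
    proof -
      have "cmod (h 0) = Re (L q q)" unfolding h_def \<gamma>0 using Lqq by (metis abs_of_nonneg norm_of_real)
      then show ?thesis by (simp add: power2_eq_square)
    qed
    finally show "(cmod (h t))\<^sup>2 \<le> (cmod (h 0))\<^sup>2" .
  qed simp
  then have "h constant_on ball 0 e"
    using s by (intro maximum_modulus_principle[OF hol_h, of "ball 0 s" 0]) auto
  then have hc: "h t = L q q" if "t \<in> ball 0 e" for t
    using that e \<gamma>0 unfolding constant_on_def h_def by (metis centre_in_ball)
  define t where "t = complex_of_real (s / 2)"
  have t: "t \<in> ball 0 s" "t \<in> ball 0 e" "t \<noteq> 0" using s by (auto simp: t_def)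
  define p where "p = \<gamma> t"
  have "\<delta> * (norm (p - q))\<^sup>2 = \<delta> * (norm p)\<^sup>2 + \<delta> * (norm q)\<^sup>2 - 2 * \<delta> * Re (cin p q)"
    by (simp add: Re_cin power2_norm_eq_inner inner_diff inner_commute algebra_simps)
  also have "\<dots> \<le> Re (L p p) + Re (L q q) - 2 * Re (L p q)"
    using psh_kernel_polarization[OF K, of p q] by (simp add: L_def cin_self algebra_simps)
  also have "\<dots> \<le> 0" using le[OF t(1)] hc[OF t(2)] by (simp add: h_def p_def)
  finally have "\<delta> * (norm (p - q))\<^sup>2 \<le> 0" .
  then have "p = q" using \<delta> by (simp add: mult_le_0_iff)
  then show False using nonconst[OF t(2,3)] by (simp add: p_def)
qed

text \<open>A single point is removable: the factor \<open>norm (z - q)\<^sup>2\<close> plays the role of the pole \<open>log (norm (z - q))\<close>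
  which is added to the logarithm of the given plurisubharmonic function.\<close>
lemma no_peak_at_limit:
  fixes V :: "(complex ^ 'n) set"
  assumes V: "closed V" and q: "q islimpt V" and r: "r > 0"
    and good: "\<And>p. p \<in> V \<Longrightarrow> dist p q < r \<Longrightarrow> p \<noteq> q \<Longrightarrow> no_peak_at V p"
  shows "no_peak_at V q"
  unfolding no_peak_at_def
proof (intro allI impI, rule ccontr)
  fix K :: "complex ^ 'n \<Rightarrow> complex ^ 'n \<Rightarrow> complex" and \<delta> r1 :: real
  assume K: "psh_kernel K" and \<delta>: "\<delta> > 0" and r1: "r1 > 0"
  assume "\<not> (\<exists>z\<in>V. dist z q < r1 \<and> Re (K q q) + \<delta> * (norm q)\<^sup>2 < Re (K z z) + \<delta> * (norm z)\<^sup>2)"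
  then have peak: "Re (K z z) + \<delta> * (norm z)\<^sup>2 \<le> Re (K q q) + \<delta> * (norm q)\<^sup>2" if "z \<in> V" "dist z q < r1" for z
    using that by force
  have qV: "q \<in> V" using V q closed_limpt by blast
  define s where "s = min r r1 / 2"
  have s: "s > 0" "s < r" "s < r1" using r r1 by (auto simp: s_def)
  define c where "c = \<delta> / 2 * s\<^sup>2"
  have c: "c > 0" using \<delta> s by (simp add: c_def)
  \<comment> \<open>By the parallelogram law, replacing the \<open>\<delta>\<close> term by half of
    \<open>(norm (z + q))\<^sup>2\<close> turns the weak peak at \<open>q\<close> into a strict one
    with quadratic drop. The constant \<open>c\<close> ensures \<open>m \<ge> c\<close>, so that
    \<open>m - c\<close> can be raised to powers monotonically.\<close>
  define L where "L z w = K z w + of_real (\<delta>/2) * cin (z + q) (w + q) + of_real c" for z w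
  have L: "psh_kernel L" unfolding L_def using K \<delta> c
    by (intro psh_kernel_add psh_kernel_scale psh_kernel_cin psh_kernel_const) auto
  define \<psi> where "\<psi> z = Re (L z z)" for z
  have \<psi>: "\<psi> z = Re (K z z) + \<delta>/2 * (norm (z + q))\<^sup>2 + c" for z by (simp add: \<psi>_def L_def cin_self)
  have \<psi>0: "\<psi> z \<ge> 0" for z using L by (simp add: \<psi>_def psh_kernel_def)
  have cont_L: "continuous_on UNIV (\<lambda>z. L z z)" using L by (simp add: psh_kernel_def)
  then have cont_\<psi>: "continuous_on UNIV \<psi>" unfolding \<psi>_def by (intro continuous_intros)
  define m where "m = \<psi> q"
  have mc: "m \<ge> c" using K \<delta> unfolding m_def \<psi> by (simp add: psh_kernel_def)
  have strict: "\<psi> z \<le> m - \<delta>/2 * (dist z q)\<^sup>2" if "z \<in> V" "dist z q < r1" for z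
  proof -
    have par: "(norm (z + q))\<^sup>2 = 2 * (norm z)\<^sup>2 + 2 * (norm q)\<^sup>2 - (dist z q)\<^sup>2"
      by (simp add: dist_norm power2_norm_eq_inner inner_diff inner_add inner_commute algebra_simps)
    have "(norm (q + q))\<^sup>2 = 4 * (norm q)\<^sup>2"
      unfolding scaleR_2[symmetric] by (simp add: power_mult_distrib)
    then show ?thesis using peak[OF that] unfolding m_def \<psi> par by (simp add: algebra_simps)
  qed
  have bd: "\<psi> z \<le> m - c" if "z \<in> V" "dist z q = s" for z
    using strict[of z] that s by (simp add: c_def)
  have "\<forall>\<^sub>F z in at q. \<psi> z > m - c/2"
    using cont_\<psi> c unfolding m_def
    by (intro order_tendstoD) (auto simp: continuous_on_eq_continuous_at isCont_def)
  then obtain d where d: "d > 0" "\<And>z. z \<noteq> q \<Longrightarrow> dist z q < d \<Longrightarrow> \<psi> z > m - c/2"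
    unfolding eventually_at by blast
  obtain p where p: "p \<in> V" "p \<noteq> q" "dist p q < min d s"
    using q d s unfolding islimpt_approachable by (meson min_less_iff_conj)
  have pm: "\<psi> p > m - c/2" using d p by simp
  \<comment> \<open>A high power of \<open>\<psi>\<close> outweighs the small factor
    \<open>(dist p q)\<^sup>2\<close>. After multiplication by the squared distance to
    \<open>q\<close>, the value at \<open>p\<close> exceeds all values on the sphere of radius
    \<open>s\<close>, while the value at \<open>q\<close> is 0; the maximum must then fall on a good
    point.\<close>
  define x where "x = (m - c) / (m - c/2)"
  have x: "0 \<le> x" "x < 1" using mc c by (auto simp: x_def divide_simps)
  obtain n where n: "x ^ n < (dist p q)\<^sup>2 / s\<^sup>2"
    using real_arch_pow_inv[of "(dist p q)\<^sup>2 / s\<^sup>2" x] x p s by auto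
  have mc2: "m - c/2 > 0" using mc c by simp
  have "(m - c) ^ n = x ^ n * (m - c/2) ^ n" using mc2 by (simp add: x_def power_divide)
  also have "\<dots> < (dist p q)\<^sup>2 / s\<^sup>2 * (m - c/2) ^ n" using n mc2 by (intro mult_strict_right_mono) auto
  finally have "(m - c) ^ n * s\<^sup>2 < (dist p q)\<^sup>2 * (m - c/2) ^ n" using s by (simp add: field_simps)
  also have "\<dots> \<le> \<psi> p ^ n * (dist p q)\<^sup>2"
    using pm mc2 by (subst mult.commute) (intro mult_right_mono power_mono, auto)
  finally have gap: "(m - c) ^ n * s\<^sup>2 < \<psi> p ^ n * (dist p q)\<^sup>2" .
  define M where "M z w = L z w ^ n * cin (z + (- q)) (w + (- q))" for z w
  have M: "psh_kernel M" unfolding M_def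
    by (intro psh_kernel_mult psh_kernel_power psh_kernel_cin L)
  have M_diag: "Re (M z z) = \<psi> z ^ n * (dist z q)\<^sup>2" for z
    unfolding M_def \<psi>_def
    by (subst psh_kernel_Re_mult[OF psh_kernel_power[OF L] psh_kernel_cin])
       (simp add: psh_kernel_Re_power[OF L] cin_self dist_norm)
  define R where "R = norm q + s"
  have R: "R > 0" using s by (simp add: R_def add_nonneg_pos)
  \<comment> \<open>On \<open>cball q s\<close> the added term is at most
    \<open>\<eta> * R\<^sup>2\<close>, which is half of the gap.\<close>
  define \<eta> where "\<eta> = (\<psi> p ^ n * (dist p q)\<^sup>2 - (m - c) ^ n * s\<^sup>2) / (2 * R\<^sup>2)"
  have \<eta>: "\<eta> > 0" using gap R by (simp add: \<eta>_def)
  have gap2: "(m - c) ^ n * s\<^sup>2 + \<eta> * R\<^sup>2 < \<psi> p ^ n * (dist p q)\<^sup>2"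
    using gap R by (simp add: \<eta>_def field_simps)
  define \<phi> where "\<phi> z = Re (M z z) + \<eta> * (norm z)\<^sup>2" for z
  have "continuous_on UNIV (\<lambda>z. M z z)" using M by (simp add: psh_kernel_def)
  then have "continuous_on UNIV \<phi>" unfolding \<phi>_def by (intro continuous_intros)
  then have "continuous_on (V \<inter> cball q s) \<phi>" by (rule continuous_on_subset) simp
  moreover have "compact (V \<inter> cball q s)" using V by (simp add: closed_Int_compact)
  moreover have pin: "p \<in> V \<inter> cball q s" using p by (simp add: dist_commute)
  ultimately obtain y where "y \<in> V \<inter> cball q s" "\<forall>z\<in>V \<inter> cball q s. \<phi> z \<le> \<phi> y"
    using continuous_attains_sup[of "V \<inter> cball q s" \<phi>] by blast
  then have y: "y \<in> V" "dist y q \<le> s" "\<And>z. z \<in> V \<Longrightarrow> dist z q \<le> s \<Longrightarrow> \<phi> z \<le> \<phi> y"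
    by (auto simp: dist_commute)
  have nb: "(norm z)\<^sup>2 \<le> R\<^sup>2" if "dist z q \<le> s" for z
    using that norm_triangle_ineq2[of z q] by (intro power_mono) (auto simp: R_def dist_norm)
  have py: "\<psi> p ^ n * (dist p q)\<^sup>2 \<le> \<phi> y"
  proof -
    have "0 \<le> \<eta> * (norm p)\<^sup>2" using \<eta> by simp
    moreover have "\<phi> p \<le> \<phi> y" using y(3) p by simp
    ultimately show ?thesis by (simp add: \<phi>_def M_diag)
  qed
  have yR: "\<eta> * (norm y)\<^sup>2 \<le> \<eta> * R\<^sup>2" using nb[OF y(2)] \<eta> by simp
  have nonneg: "(m - c) ^ n * s\<^sup>2 \<ge> 0" using mc by simp
  have "y \<noteq> q"
  proof
    assume "y = q"
    then have "\<phi> y = \<eta> * (norm y)\<^sup>2" by (simp add: \<phi>_def M_diag)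
    then show False using py yR gap2 nonneg by linarith
  qed
  have "dist y q < s"
  proof (rule ccontr)
    assume "\<not> dist y q < s"
    then have ys: "dist y q = s" using y(2) by simp
    have "\<psi> y ^ n * (dist y q)\<^sup>2 \<le> (m - c) ^ n * s\<^sup>2"
      unfolding ys using bd[OF y(1) ys] \<psi>0 by (intro mult_right_mono power_mono) auto
    then have "\<phi> y \<le> (m - c) ^ n * s\<^sup>2 + \<eta> * R\<^sup>2" using yR by (simp add: \<phi>_def M_diag)
    then show False using py gap2 by linarith
  qed
  have "no_peak_at V y" using good y(1) \<open>y \<noteq> q\<close> \<open>dist y q < s\<close> s by simp
  then obtain z where z: "z \<in> V" "dist z y < s - dist y q" "\<phi> y < \<phi> z"
    using M \<eta> \<open>dist y q < s\<close> unfolding no_peak_at_def \<phi>_def by (meson diff_gt_0_iff_gt)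
  have "dist z q \<le> s" using z(2) dist_triangle[of z q y] by linarith
  then show False using y(3)[OF z(1)] z(3) by simp
qed

text \<open>Up to the constant \<open>(norm a)\<^sup>2\<close>, the squared distance to
  \<open>a\<close> is half the squared distance to \<open>2 *\<^sub>R a\<close>, a kernel diagonal,
  plus half of \<open>(norm z)\<^sup>2\<close>, the strict term.\<close>

lemma no_peak_at_imp_not_local_farthest:
  fixes V :: "(complex ^ 'n) set"
  assumes "no_peak_at V q" "r > 0"
  shows "\<exists>z\<in>V. dist z q < r \<and> dist q a < dist z a"
proof -
  have "psh_kernel (\<lambda>z w. of_real (1/2) * cin (z + (- (2 *\<^sub>R a))) (w + (- (2 *\<^sub>R a))))"
    by (intro psh_kernel_scale psh_kernel_cin) auto
  then obtain z where z: "z \<in> V" "dist z q < r"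
     "1/2 * (norm (q - 2 *\<^sub>R a))\<^sup>2 + 1/2 * (norm q)\<^sup>2 < 1/2 * (norm (z - 2 *\<^sub>R a))\<^sup>2 + 1/2 * (norm z)\<^sup>2"
    using assms unfolding no_peak_at_def cin_self
    by (elim allE[of _ "\<lambda>z w. of_real (1/2) * cin (z + (- (2 *\<^sub>R a))) (w + (- (2 *\<^sub>R a)))"] allE[of _ "1/2::real"] allE[of _ r])
       (auto simp: cin_self)
  have *: "1/2 * (norm (x - 2 *\<^sub>R a))\<^sup>2 + 1/2 * (norm x)\<^sup>2 = (dist x a)\<^sup>2 + (norm a)\<^sup>2" for x
    by (simp add: dist_norm power2_norm_eq_inner inner_diff inner_commute algebra_simps)
  have "(dist q a)\<^sup>2 < (dist z a)\<^sup>2" using z(3) unfolding * by simp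
  then have "dist q a < dist z a" by (rule power2_less_imp_less) simp
  then show ?thesis using z by blast
qed

section \<open>Iterated derivatives and induction over strata\<close>

primrec pds :: "'n list \<Rightarrow> (complex ^ 'n \<Rightarrow> complex) \<Rightarrow> complex ^ 'n \<Rightarrow> complex" where
  "pds [] f = f"
| "pds (j # js) f = pd j (pds js f)"

lemma pds_append: "pds (ks @ js) f = pds ks (pds js f)"
  by (induction ks) simp_all

lemma holo_CN_pds: "holo_CN f U \<Longrightarrow> holo_CN (pds js f) U"
  by (induction js) (simp_all add: holo_CN_pd)

lemma higher_deriv_slice:
  "(deriv ^^ i) (\<lambda>t. f (z + axis k t)) = (\<lambda>t. pds (replicate i k) f (z + axis k t))"
proof (induction i)
  case (Suc i)
  show ?case unfolding funpow.simps o_def Suc.IH by (simp add: fun_eq_iff deriv_slice)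
qed simp

text \<open>The coordinates are freed one at a time by the identity theorem in one variable.
  Carrying all derivatives through the induction supplies the vanishing Taylor coefficients in each
  new direction.\<close>

lemma holo_CN_vanishing:
  fixes f :: "complex ^ 'n \<Rightarrow> complex"
  assumes f: "holo_CN f U" and q: "q \<in> U" and van: "\<And>js. pds js f q = 0"
  shows "\<forall>\<^sub>F z in nhds q. f z = 0"
proof -
  obtain e where e: "e > 0" "ball q e \<subseteq> U" using holo_CN_open[OF f] q open_contains_ball by blast
  have "\<forall>z\<in>ball q e. (\<forall>k. k \<notin> S \<longrightarrow> z $ k = q $ k) \<longrightarrow> (\<forall>js. pds js f z = 0)" for S :: "'n set"
  proof (induction S rule: finite_induct[OF finite])
    case 1
    have "z = q" if "\<forall>k. z $ k = q $ k" for z using that by (simp add: vec_eq_iff)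
    then show ?case using van by auto
  next
    case (2 k S)
    show ?case
    proof (intro ballI impI allI)
      fix z js assume z: "z \<in> ball q e" "\<forall>i. i \<notin> insert k S \<longrightarrow> z $ i = q $ i"
      \<comment> \<open>Resetting coordinate \<open>k\<close> to its value at \<open>q\<close> stays
        in the ball and lands where the induction hypothesis applies; \<open>z\<close> lies on the
        coordinate line through \<open>y\<close>, whose part in the ball is convex.\<close>
      define y where "y = z - axis k (z $ k - q $ k)"
      have "norm (y - q) \<le> norm (z - q)"
        by (rule norm_le_componentwise_cart) (simp add: y_def axis_def)
      then have y: "y \<in> ball q e" using z(1) by (simp add: dist_norm norm_minus_commute)
      have yk: "\<forall>i. i \<notin> S \<longrightarrow> y $ i = q $ i" using z(2) by (auto simp: y_def axis_def)
      define T where "T = {t. y + axis k t \<in> ball q e}"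
      have "open T" unfolding T_def
      proof -
        have "isCont (\<lambda>t. y + axis k t) x" for x
          by (intro continuous_intros linear_continuous_at[OF bounded_linear_axis])
        then have "open ((\<lambda>t. y + axis k t) -` ball q e)"
          by (intro continuous_open_vimage) auto
        then show "open {t. y + axis k t \<in> ball q e}" by (simp add: vimage_def)
      qed
      moreover have "convex T"
      proof (rule convexI)
        fix a b u v assume ab: "a \<in> T" "b \<in> T" "0 \<le> u" "0 \<le> (v::real)" "u + v = 1"
        have "y + axis k (u *\<^sub>R a + v *\<^sub>R b) = (u + v) *\<^sub>R y + axis k (u *\<^sub>R a + v *\<^sub>R b)" using ab by simp
        also have "\<dots> = u *\<^sub>R (y + axis k a) + v *\<^sub>R (y + axis k b)"
          by (simp add: vec_eq_iff axis_def algebra_simps)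
        also have "\<dots> \<in> ball q e" using ab convexD[OF convex_ball] by (simp add: T_def del: mem_ball)
        finally show "u *\<^sub>R a + v *\<^sub>R b \<in> T" by (simp add: T_def)
      qed
      moreover have "(\<lambda>t. pds js f (y + axis k t)) holomorphic_on T"
        by (rule holo_CN_slice[OF holo_CN_pds[OF f]]) (use e in \<open>auto simp: T_def\<close>)
      moreover have "(deriv ^^ i) (\<lambda>t. pds js f (y + axis k t)) 0 = 0" for i
        unfolding higher_deriv_slice pds_append[symmetric] axis_0 add_0_right using 2(3) y yk by blast
      moreover have "0 \<in> T" using y by (simp add: T_def axis_0)
      moreover have zy: "y + axis k (z $ k - q $ k) = z" by (simp add: y_def)
      then have "z $ k - q $ k \<in> T" using z(1) by (simp add: T_def)
      ultimately have "pds js f (y + axis k (z $ k - q $ k)) = 0"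
        using holomorphic_fun_eq_0_on_connected[of "\<lambda>t. pds js f (y + axis k t)" T 0 "z $ k - q $ k"]
          convex_connected by blast
      then show "pds js f z = 0" by (simp add: zy)
    qed
  qed
  from this[of UNIV] have "f z = 0" if "z \<in> ball q e" for z using that pds.simps(1) by (metis UNIV_I)
  then show ?thesis using e(1) eventually_nhds_in_open[of "ball q e" q]
    by (auto elim!: eventually_mono)
qed

definition depends_on :: "'n set \<Rightarrow> (complex ^ 'n \<Rightarrow> 'b) \<Rightarrow> bool" where
  "depends_on J f \<longleftrightarrow> (\<forall>z w. (\<forall>k\<in>J. z $ k = w $ k) \<longrightarrow> f z = f w)"

lemma depends_on_pd:
  assumes "depends_on J f" shows "depends_on J (pd j f)"
  unfolding depends_on_def
proof (intro allI impI)
  fix z w :: "complex ^ 'a" assume "\<forall>k\<in>J. z $ k = w $ k"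
  then have "(\<lambda>t. f (z + axis j t)) = (\<lambda>t. f (w + axis j t))"
    using assms unfolding depends_on_def by (intro ext) simp
  then show "pd j f z = pd j f w" by (simp add: pd_def)
qed

lemma depends_on_pds: "depends_on J f \<Longrightarrow> depends_on J (pds js f)"
  by (induction js) (simp_all add: depends_on_pd)

lemma pd_outside:
  assumes "depends_on J f" "j \<notin> J" shows "pd j f z = 0"
proof -
  have "(\<lambda>t. f (z + axis j t)) = (\<lambda>t. f z)"
  proof
    fix t
    have "\<forall>k\<in>J. (z + axis j t) $ k = z $ k" using assms(2) by (auto simp: axis_def)
    then show "f (z + axis j t) = f z" using assms(1) unfolding depends_on_def by blast
  qed
  then show ?thesis by (simp add: pd_def)
qed

lemma finite_list_of_lists_shorter:
  obtains Ls :: "'n::finite list list" where "set Ls = {ks. length ks < m}"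
proof -
  have "finite {ks :: 'n list. set ks \<subseteq> UNIV \<and> length ks \<le> m}" by (rule finite_lists_length_le) simp
  then have "finite {ks :: 'n list. length ks < m}" by (rule rev_finite_subset) auto
  then show thesis using that finite_list by blast
qed

lemma holo_map_coordinate_projection:
  "holo_map (\<lambda>z :: complex ^ 'n. \<chi> k. if k \<in> J then z $ k else c k) UNIV"
  unfolding holo_map_def
proof (intro conjI ballI)
  fix z :: "complex ^ 'n"
  define A where "A v = (\<chi> k. if k \<in> J then v $ k else 0)" for v :: "complex ^ 'n"
  have "linear A" by (rule linearI) (auto simp: A_def vec_eq_iff)
  then have "(A has_derivative A) (at z)" 
    by (simp add: linear_conv_bounded_linear bounded_linear_imp_has_derivative)
  then have "((\<lambda>z. A z + (\<chi> k. if k \<in> J then 0 else c k)) has_derivative (\<lambda>v. A v + 0)) (at z)"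
    by (intro has_derivative_add has_derivative_const)
  moreover have "(\<lambda>z. A z + (\<chi> k. if k \<in> J then 0 else c k)) = (\<lambda>z. \<chi> k. if k \<in> J then z $ k else c k)"
    by (auto simp: A_def vec_eq_iff fun_eq_iff)
  ultimately have "((\<lambda>z. \<chi> k. if k \<in> J then z $ k else c k) has_derivative A) (at z)" by simp
  moreover have "A (c *s v) = c *s A v" for c v by (simp add: A_def vec_eq_iff)
  ultimately show "\<exists>L. ((\<lambda>z. \<chi> k. if k \<in> J then z $ k else c k) has_derivative L) (at z) \<and>
      (\<forall>c v. L (c *s v) = c *s L v)" by blast
qed simp

text \<open>The germ at \<open>q\<close> of the common zero set of \<open>G\<close> lies in the submanifold of fixed points of \<open>\<Gamma>\<close>, which
  is parametrized by the coordinates in \<open>J\<close>; off this zero set there are no peak points.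
  Either some member of \<open>G\<close> has finite order at \<open>q\<close> along the submanifold, and then the points of
  maximal order lie in a smooth hypersurface of it, or the submanifold is contained in \<open>V\<close>.\<close>
lemma no_peak_at_analytic:
  fixes V :: "(complex ^ 'n) set" and \<Gamma> :: "complex ^ 'n \<Rightarrow> complex ^ 'n"
  assumes V: "closed V" "\<And>q. q \<in> V \<Longrightarrow> q islimpt V"
    and U: "open U" "q \<in> U" and G: "\<And>f. f \<in> set G \<Longrightarrow> holo_CN f U"
    and \<Gamma>: "holo_map \<Gamma> U" "depends_on J \<Gamma>" "\<And>z k. k \<in> J \<Longrightarrow> \<Gamma> z $ k = z $ k"
    and sub: "\<And>z. z \<in> U \<Longrightarrow> (\<And>f. f \<in> set G \<Longrightarrow> f z = 0) \<Longrightarrow> z \<in> V \<and> \<Gamma> z = z"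
    and q: "\<And>f. f \<in> set G \<Longrightarrow> f q = 0"
    and good: "\<And>p f. p \<in> V \<Longrightarrow> p \<in> U \<Longrightarrow> f \<in> set G \<Longrightarrow> f p \<noteq> 0 \<Longrightarrow> no_peak_at V p"
  shows "no_peak_at V q"
  using U G \<Gamma> sub q good
proof (induction "card J" arbitrary: J U q G \<Gamma>)
  case 0
  \<comment> \<open>Now \<open>\<Gamma>\<close> is constant, so the common zero set in
    \<open>U\<close> is just \<open>q\<close>, and all other nearby points of \<open>V\<close> are
    good.\<close>
  have J: "J = {}" using 0(1) card_0_eq[of J] by simp
  have qV: "q \<in> V" "\<Gamma> q = q" using 0 by blast+
  obtain r where r: "r > 0" "ball q r \<subseteq> U" using 0(2,3) open_contains_ball by blast
  show ?case
  proof (rule no_peak_at_limit[OF V(1) V(2)[OF qV(1)] r(1)])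
    fix p assume p: "p \<in> V" "dist p q < r" "p \<noteq> q"
    then have pU: "p \<in> U" using r by (auto simp: dist_commute)
    have "\<Gamma> p = \<Gamma> q" using 0(6) unfolding J depends_on_def by blast
    then have "\<exists>f\<in>set G. f p \<noteq> 0" using 0(8)[OF pU] qV p(3) by force
    then show "no_peak_at V p" using 0(10) p pU by blast
  qed
next
  case (Suc n)
  note IH = Suc(1) and cardJ = Suc(2) and openU = Suc(3) and qU = Suc(4) and holG = Suc(5)
    and hol\<Gamma> = Suc(6) and dep\<Gamma> = Suc(7) and id\<Gamma> = Suc(8) and sub = Suc(9) and q0 = Suc(10) and good = Suc(11)
  define U1 where "U1 = {z\<in>U. \<Gamma> z \<in> U}"
  have qV: "q \<in> V" "\<Gamma> q = q" using sub[OF qU] q0 by blast+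
  have openU1: "open U1" unfolding U1_def by (rule holo_map_open_vimage[OF hol\<Gamma> openU])
  have qU1: "q \<in> U1" using qU qV by (simp add: U1_def)
  have holG\<Gamma>: "holo_CN (\<lambda>z. f (\<Gamma> z)) U1" if "f \<in> set G" for f
    unfolding U1_def by (rule holo_CN_compose[OF holG[OF that] hol\<Gamma>])
  show ?case
  proof (cases "\<forall>f\<in>set G. \<forall>js. pds js (\<lambda>z. f (\<Gamma> z)) q = 0")
    case True
    \<comment> \<open>All \<open>f\<close> vanish on the image of a neighbourhood of
      \<open>q\<close> under \<open>\<Gamma>\<close>, which therefore lies in \<open>V\<close>.
      Moving coordinate \<open>j\<close> gives a holomorphic disc there, injective because
      \<open>\<Gamma>\<close> preserves that coordinate.\<close>
    obtain j where j: "j \<in> J" using cardJ by fastforce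
    have "\<forall>\<^sub>F z in nhds q. \<forall>f\<in>set G. f (\<Gamma> z) = 0"
      using True holG\<Gamma> qU1 by (intro eventually_ball_finite ballI holo_CN_vanishing) auto
    moreover have "\<forall>\<^sub>F z in nhds q. z \<in> U1" by (rule eventually_nhds_in_open[OF openU1 qU1])
    ultimately have "\<forall>\<^sub>F z in nhds q. z \<in> U1 \<and> (\<forall>f\<in>set G. f (\<Gamma> z) = 0)"
      by eventually_elim blast
    then obtain e where e: "e > 0" "\<And>z. dist z q < e \<Longrightarrow> z \<in> U1" "\<And>z f. dist z q < e \<Longrightarrow> f \<in> set G \<Longrightarrow> f (\<Gamma> z) = 0"
      unfolding eventually_nhds_metric by blast
    have near: "dist (q + axis j t) q < e" if "t \<in> ball 0 e" for t
      using that by (simp add: dist_norm norm_axis)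
    show ?thesis
    proof (rule no_peak_at_disc[of e "\<lambda>t. \<Gamma> (q + axis j t)"])
      show "e > 0" by fact
      show "\<Gamma> (q + axis j 0) = q" using qV by (simp add: axis_0)
      show "(\<lambda>t. f (\<Gamma> (q + axis j t))) holomorphic_on ball 0 e" if "holo_CN f UNIV" for f
        using holo_CN_compose[OF that hol\<Gamma>] e(2)[OF near]
        by (intro holo_CN_slice[where f = "\<lambda>z. f (\<Gamma> z)" and U = U]) (auto simp: U1_def)
      show "continuous_on (ball 0 e) (\<lambda>t. \<Gamma> (q + axis j t))"
        using e(2)[OF near]
        by (intro continuous_on_compose2[OF holo_map_continuous[OF hol\<Gamma>]] continuous_intros
            linear_continuous_on[OF bounded_linear_axis]) (auto simp: U1_def)
      show "\<Gamma> (q + axis j t) \<in> V" if "t \<in> ball 0 e" for t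
        using e(2,3)[OF near[OF that]] sub by (auto simp: U1_def)
      show "\<Gamma> (q + axis j t) \<noteq> q" if "t \<in> ball 0 e" "t \<noteq> 0" for t
        using id\<Gamma>[OF j, of "q + axis j t"] that(2) by (auto simp: axis_def)
    qed
  next
    case False
    then obtain f0 js0 where f0: "f0 \<in> set G" "pds js0 (\<lambda>z. f0 (\<Gamma> z)) q \<noteq> 0" by blast
    define \<phi> where "\<phi> z = f0 (\<Gamma> z)" for z
    have hol\<phi>: "holo_CN \<phi> U1" unfolding \<phi>_def by (rule holG\<Gamma>[OF f0(1)])
    have dep\<phi>: "depends_on J \<phi>" unfolding \<phi>_def depends_on_def
      using dep\<Gamma> unfolding depends_on_def by (intro allI impI arg_cong[where f = f0]) blast
    have "no_peak_at V p" if "p \<in> U1" "\<And>f. f \<in> set G \<Longrightarrow> f p = 0" "pds js \<phi> p \<noteq> 0" for p js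
      using that
    \<comment> \<open>Induction on the length of a nonvanishing derivative: if none is shorter, that
      length is the order of \<open>\<phi>\<close> at \<open>p\<close>.\<close>
    proof (induction "length js" arbitrary: js p rule: less_induct)
      case less
      note pU1 = less(2) and p0 = less(3)
      have pU: "p \<in> U" using pU1 by (simp add: U1_def)
      have pV: "p \<in> V" "\<Gamma> p = p" using sub[OF pU] p0 by blast+
      show ?case
      proof (cases "\<exists>ks. length ks < length js \<and> pds ks \<phi> p \<noteq> 0")
        case True
        then show ?thesis using less(1) pU1 p0 by blast
      next
        case False
        then have minimal: "pds ks \<phi> p = 0" if "length ks < length js" for ks using that by blast
        have "\<phi> p = 0" using p0[OF f0(1)] pV by (simp add: \<phi>_def)
        then obtain j js' where js: "js = j # js'" using less(4) by (cases js) auto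
        \<comment> \<open>One derivative short of the order, \<open>D\<close> vanishes at
          \<open>p\<close> but its \<open>j\<close>-th partial derivative does not, so its zero set
          is smooth there.\<close>
        define D where "D = pds js' \<phi>"
        have D: "holo_CN D U1" "D p = 0" "pd j D p \<noteq> 0" "depends_on J D"
          using holo_CN_pds[OF hol\<phi>] minimal[of js'] less(4) depends_on_pds[OF dep\<phi>]
          by (auto simp: D_def js)
        have j: "j \<in> J" using D(3) pd_outside[OF D(4)] by blast
        obtain N W H where N: "open N" "p \<in> N" and H: "holo_map H W" "p - axis j (p $ j) \<in> W"
          "\<And>z. z \<in> N \<Longrightarrow> D z = 0 \<Longrightarrow> H (z - axis j (z $ j)) = z"
          by (rule holo_CN_zero_set_graph[OF D(1) pU1 D(2,3)]) (rule that; assumption)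
        \<comment> \<open>Coordinates outside \<open>J\<close> are frozen at those of
          \<open>p\<close>, which does not affect \<open>D\<close>. Setting coordinate
          \<open>j\<close> to 0 as well gives the input expected by \<open>H\<close>, depending on
          \<open>J - {j}\<close> alone.\<close>
        define proj where "proj z = (\<chi> k. if k \<in> J - {j} then z $ k else if k = j then 0 else p $ k)" for z :: "complex ^ 'n"
        define hat where "hat z = (\<chi> k. if k \<in> J then z $ k else p $ k)" for z :: "complex ^ 'n"
        have hat_proj: "hat z - axis j (hat z $ j) = proj z" for z
          using j by (auto simp: hat_def proj_def vec_eq_iff axis_def)
        have hat_p: "hat p = p" by (simp add: hat_def vec_eq_iff)
        have proj_p: "proj p = p - axis j (p $ j)" using hat_proj[of p] by (simp add: hat_p)
        define g where "g z = H (proj z) $ j" for z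
        define Ug where "Ug = {z\<in>UNIV. proj z \<in> {w\<in>W. H w \<in> UNIV}}"
        have g: "holo_CN g Ug" unfolding g_def Ug_def proj_def
          by (intro holo_CN_compose[OF holo_CN_compose[OF holo_CN_nth H(1)]] holo_map_coordinate_projection)
        \<comment> \<open>\<open>R\<close> projects along coordinate \<open>j\<close> to the graph
          of \<open>g\<close> and fixes the zeros of \<open>D\<close> near \<open>p\<close>, so
          \<open>\<Gamma>\<close> after \<open>R\<close> parametrizes by one coordinate
          fewer.\<close>
        define R where "R z = z + axis j (g z - z $ j)" for z
        have R: "holo_map R Ug" unfolding R_def by (rule holo_map_replace[OF g])
        have Rj: "R z $ j = g z" and Rk: "k \<noteq> j \<Longrightarrow> R z $ k = z $ k" for z k by (auto simp: R_def axis_def)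
        have R_fix: "R z = z" if "hat z \<in> N" "D z = 0" for z
        proof -
          have "D (hat z) = D z" using D(4) unfolding depends_on_def by (simp add: hat_def)
          then have "g z = hat z $ j" using H(3)[OF that(1)] that(2) by (simp add: g_def hat_proj)
          then show ?thesis using j by (simp add: R_def hat_def axis_0)
        qed
        define U' where "U' = U1 \<inter> {z\<in>Ug. R z \<in> U} \<inter> hat -` N"
        have hatc: "continuous_on UNIV hat" unfolding hat_def
          by (rule holo_map_continuous[OF holo_map_coordinate_projection])
        have openU': "open U'" unfolding U'_def
          using openU1 holo_map_open_vimage[OF R openU] open_vimage[OF N(1) hatc] by blast
        have "p \<in> Ug" using H(2) by (simp add: Ug_def proj_p)
        then have pU': "p \<in> U'" using pU1 pU N(2) R_fix[of p] D(2) by (simp add: U'_def hat_p)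
        obtain Ls :: "'n list list" where Ls: "set Ls = {ks. length ks < length js}"
          using finite_list_of_lists_shorter by blast
        \<comment> \<open>The new common zeros are those where \<open>\<phi>\<close> has order at
          least \<open>length js\<close>, and \<open>D\<close> is among the added functions. Where
          an added function is nonzero, the order is lower and the inner induction applies.\<close>
        define G' where "G' = G @ map (\<lambda>ks. pds ks \<phi>) Ls"
        show ?thesis
        proof (rule IH[of "J - {j}" U' p G' "\<lambda>z. \<Gamma> (R z)"])
          show "n = card (J - {j})" using cardJ j by simp
          show "open U'" "p \<in> U'" by fact+
          show "holo_CN f U'" if "f \<in> set G'" for f
          proof -
            have "holo_CN f U1" using that holo_CN_pds[OF hol\<phi>] holo_CN_subset[OF holG openU1]
              by (auto simp: G'_def U1_def)
            then show ?thesis by (rule holo_CN_subset[OF _ openU']) (auto simp: U'_def)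
          qed
          show "holo_map (\<lambda>z. \<Gamma> (R z)) U'"
            by (rule holo_map_subset[OF holo_map_compose[OF hol\<Gamma> R] openU']) (auto simp: U'_def)
          show "depends_on (J - {j}) (\<lambda>z. \<Gamma> (R z))" unfolding depends_on_def
          proof (intro allI impI)
            fix z w :: "complex ^ 'n" assume zw: "\<forall>k\<in>J - {j}. z $ k = w $ k"
            then have "proj z = proj w" by (simp add: proj_def vec_eq_iff)
            then have "g z = g w" by (simp add: g_def)
            then have "\<forall>k\<in>J. R z $ k = R w $ k" using zw Rj Rk by (metis DiffI singletonD)
            then show "\<Gamma> (R z) = \<Gamma> (R w)" using dep\<Gamma> unfolding depends_on_def by blast
          qed
          show "\<Gamma> (R z) $ k = z $ k" if "k \<in> J - {j}" for z k
            using that id\<Gamma>[of k "R z"] Rk by simp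
          show "z \<in> V \<and> \<Gamma> (R z) = z" if z: "z \<in> U'" and G'z: "\<And>f. f \<in> set G' \<Longrightarrow> f z = 0" for z
          proof -
            have zV: "z \<in> V \<and> \<Gamma> z = z" using z G'z by (intro sub) (auto simp: U'_def U1_def G'_def)
            have "D z = 0" using G'z[of D] Ls by (auto simp: G'_def D_def js)
            then have "R z = z" using z by (intro R_fix) (auto simp: U'_def)
            then show ?thesis using zV by simp
          qed
          show "f p = 0" if "f \<in> set G'" for f
            using that p0 minimal Ls by (auto simp: G'_def)
          show "no_peak_at V x" if x: "x \<in> V" "x \<in> U'" "f \<in> set G'" "f x \<noteq> 0" for x f
          proof (cases "\<exists>f\<in>set G. f x \<noteq> 0")
            case True
            then show ?thesis using good x by (auto simp: U'_def U1_def)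
          next
            case False
            then obtain ks where "length ks < length js" "pds ks \<phi> x \<noteq> 0"
              using x(3,4) Ls by (auto simp: G'_def)
            then show ?thesis using less(1)[of ks x] False x(2) by (auto simp: U'_def)
          qed
        qed
      qed
    qed
    then show ?thesis using qU1 q0 f0(2) unfolding \<phi>_def by blast
  qed
qed

section \<open>From subvarieties to the theorem\<close>

lemma analytic_subvariety_no_local_farthest:
  fixes V :: "(complex ^ 'n) set"
  assumes V: "analytic_subvariety V" and lim: "\<And>q. q \<in> V \<Longrightarrow> q islimpt V"
  shows "no_local_farthest V"
  unfolding no_local_farthest_def
proof (intro conjI allI ballI impI)
  show cl: "closed V" using V by (simp add: analytic_subvariety_def)
  fix a q and r :: real assume q: "q \<in> V" and r: "r > 0"
  obtain U fs where U: "open U" "q \<in> U" "\<And>f. f \<in> set fs \<Longrightarrow> holo_CN f U" "V \<inter> U = {z\<in>U. \<forall>f\<in>set fs. f z = 0}"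
    using V q unfolding analytic_subvariety_def by blast
  have "no_peak_at V q"
  \<comment> \<open>The induction starts from the whole space with local equations of
    \<open>V\<close>; the condition on points off the zero set is then vacuous.\<close>
  proof (rule no_peak_at_analytic[OF cl lim U(1-3), where \<Gamma> = "\<lambda>z. z" and J = UNIV])
    show "holo_map (\<lambda>z. z) U" unfolding holo_map_def using U(1)
      by (auto intro!: exI[of _ "\<lambda>v. v"] has_derivative_ident)
    show "depends_on UNIV (\<lambda>z :: complex ^ 'n. z)" by (simp add: depends_on_def vec_eq_iff)
    show "z \<in> V \<and> z = z" if "z \<in> U" "\<And>f. f \<in> set fs \<Longrightarrow> f z = 0" for z
      using that U(4) by blast
    show "f q = 0" if "f \<in> set fs" for f using that U(2,4) q by blast
    show "no_peak_at V p" if "p \<in> V" "p \<in> U" "f \<in> set fs" "f p \<noteq> 0" for p f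
      using that U(4) by blast
  qed auto
  then show "\<exists>z\<in>V. dist z q < r \<and> dist q a < dist z a" using r by (rule no_peak_at_imp_not_local_farthest)
qed

text \<open>Near an isolated point \<open>V\<close> is cut out by the coordinate functions
  \<open>z $ k - q $ k\<close>, whose differentials are independent. Hence pure positive dimension
  excludes isolated points.\<close>

lemma isolated_regular_point_dim_0:
  fixes V :: "(complex ^ 'n) set"
  assumes q: "q \<in> V" "\<not> q islimpt V"
  shows "regular_point_dim V q 0"
proof -
  obtain U where U: "open U" "q \<in> U" "\<And>y. y \<in> V \<Longrightarrow> y \<in> U \<Longrightarrow> y = q"
    using q unfolding islimpt_def by blast
  obtain ks :: "'n list" where ks: "set ks = UNIV" "distinct ks" using finite_distinct_list[of "UNIV :: 'n set"] by auto
  have len: "length ks = CARD('n)" using distinct_card[OF ks(2)] ks(1) by simp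
  define fs where "fs = map (\<lambda>k z. z $ k - q $ k) ks"
  define fs' where "fs' = map (\<lambda>k v :: complex ^ 'n. v $ k) ks"
  have deriv: "cderiv_at (\<lambda>z. z $ k - q $ k) (\<lambda>v. v $ k) z" for z and k :: 'n
    unfolding cderiv_at_def
    by (auto intro!: derivative_eq_intros bounded_linear.has_derivative[OF bounded_linear_vec_nth])
  have "\<exists>v. \<forall>i<length fs. (fs' ! i) v = w i" for w :: "nat \<Rightarrow> complex"
  proof -
    define v where "v = (\<chi> k. w (the_inv_into {..<length ks} ((!) ks) k))"
    have "v $ (ks ! i) = w i" if "i < length ks" for i
      using that the_inv_into_f_f[OF inj_on_nth[OF ks(2)], of "{..<length ks}" i] by (auto simp: v_def)
    then show ?thesis by (intro exI[of _ v]) (simp add: fs_def fs'_def)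
  qed
  moreover have "V \<inter> U = {z\<in>U. \<forall>f\<in>set fs. f z = 0}"
  proof -
    have "(\<forall>f\<in>set fs. f z = 0) \<longleftrightarrow> z = q" for z by (auto simp: fs_def ks(1) vec_eq_iff)
    then have "{z\<in>U. \<forall>f\<in>set fs. f z = 0} = {q}" using U(2) by auto
    moreover have "V \<inter> U = {q}" using U q(1) by blast
    ultimately show ?thesis by simp
  qed
  moreover have "\<forall>f\<in>set fs. holo_CN f U" using deriv U(1) by (auto simp: fs_def holo_CN_def)
  moreover have "\<forall>i<length fs. cderiv_at (fs ! i) (fs' ! i) q" using deriv by (simp add: fs_def fs'_def)
  moreover have "length fs = CARD('n) - 0" "length fs' = length fs" by (simp_all add: fs_def fs'_def len)
  ultimately show ?thesis unfolding regular_point_dim_def using q(1) U(1,2) by blast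
qed

theorem theorem6p1:
  fixes \<rho> :: real
  assumes "CARD('n) \<ge> 2" and "\<rho> > 1"
  shows "\<exists>X :: (complex ^ 'n) set. cantor_set X \<and> X \<subseteq> {z. 1 < norm z \<and> norm z < \<rho>} \<and>
           cball 0 1 \<subseteq> rational_hull (CARD('n) - 1) X"
proof -
  obtain X :: "(complex ^ 'n) set" where X: "cantor_set X" "X \<subseteq> {z. 1 < norm z \<and> norm z < \<rho>}"
      "\<And>V. no_local_farthest V \<Longrightarrow> V \<inter> cball 0 1 \<noteq> {} \<Longrightarrow> V \<inter> X \<noteq> {}"
    using cantor_set_blocking_shell[OF assms(2)] by blast
  have "V \<inter> X \<noteq> {}" if "z \<in> cball 0 1" "m \<le> CARD('n) - 1" "pure_dim_subvariety V (CARD('n) - m)" "z \<in> V" for z V m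
  proof (rule X(3))
    \<comment> \<open>Codimension at most \<open>CARD('n) - 1\<close> leaves positive dimension,
      whereas an isolated point would be a regular point of dimension 0.\<close>
    have "CARD('n) - m \<noteq> 0" using that(2) assms(1) by linarith
    then have "q islimpt V" if "q \<in> V" for q
      using that isolated_regular_point_dim_0 \<open>pure_dim_subvariety V (CARD('n) - m)\<close>
      unfolding pure_dim_subvariety_def by metis
    then show "no_local_farthest V"
      using that(3) by (intro analytic_subvariety_no_local_farthest) (auto simp: pure_dim_subvariety_def)
    show "V \<inter> cball 0 1 \<noteq> {}" using that by blast
  qed
  then have "cball 0 1 \<subseteq> rational_hull (CARD('n) - 1) X" unfolding rational_hull_def by blast
  then show ?thesis using X(1,2) by blast
qed

end
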